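(* Every relevant category is coherent. That is: if $\mathcal A$ is a relevant category, $F$ and $G$ are shapes of arities $m$ and $n$, and $\alpha,\beta:F\to G$ are two canonical transformations in $\mathcal A$ (regarded as a relevant category) with the same graph $\Gamma:\{1,\dots,n\}\to\{1,\dots,m\}$, then $\alpha=\beta$ as indexed families, i.e. $\alpha(A_1,\dots,A_m)=\beta(A_1,\dots,A_m)$ for all objects $A_1,\dots,A_m$ of $\mathcal A$.
   Context: **Relevant categories.** Composition of $f:A\to B$ and $g:B\to C$ is written $gf$. A category with multiplication is a category $\mathcal A$ with a bifunctor $\cdot:\mathcal A\times\mathcal A\to\mathcal A$ and a special object $\mathrm I$. It is *monoidal* if for all objects $A,B,C$ it has special arrows $\sigma_A:\mathrm I\cdot A\to A$, $\sigma^i_A:A\to \mathrm I\cdot A$, $\delta_A:A\cdot \mathrm I\to A$, $\delta^i_A:A\to A\cdot \mathrm I$, $\overrightarrow{b}_{A,B,C}:A\cdot(B\cdot C)\to(A\cdot B)\cdot C$, $\overleftarrow{b}_{A,B,C}:(A\cdot B)\cdot C\to A\cdot(B\cdot C)$ satisfying: $f\sigma_A=\sigma_B(1_{\mathrm I}\cdot f)$ and $f\delta_A=\delta_B(f\cdot 1_{\mathrm I})$ for $f:A\to B$; $\sigma_A\sigma^i_A=1_A$, $\sigma^i_A\sigma_A=1_{\mathrm I\cdot A}$, $\delta_A\delta^i_A=1_A$, $\delta^i_A\delta_A=1_{A\cdot \mathrm I}$; $\sigma_{\mathrm I}=\delta_{\mathrm I}$; $((f\cdot g)\cdot h)\overrightarrow{b}_{A,B,C}=\overrightarrow{b}_{D,E,F}(f\cdot(g\cdot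 h))$ for $f:A\to D$, $g:B\to E$, $h:C\to F$; $\overrightarrow{b}_{A,B,C}\overleftarrow{b}_{A,B,C}=1$, $\overleftarrow{b}_{A,B,C}\overrightarrow{b}_{A,B,C}=1$; $(\delta_A\cdot 1_B)\overrightarrow{b}_{A,\mathrm I,B}=1_A\cdot\sigma_B$; $\overrightarrow{b}_{A\cdot B,C,D}\overrightarrow{b}_{A,B,C\cdot D}=(\overrightarrow{b}_{A,B,C}\cdot 1_D)\overrightarrow{b}_{A,B\cdot C,D}(1_A\cdot\overrightarrow{b}_{B,C,D})$. It is *symmetric monoidal* if moreover it has special arrows $c_{A,B}:A\cdot B\to B\cdot A$ with: $(g\cdot f)c_{A,B}=c_{C,D}(f\cdot g)$ for $f:A\to C$, $g:B\to D$; $c_{B,A}c_{A,B}=1_{A\cdot B}$; $\sigma_Ac_{A,\mathrm I}=\delta_A$; $\overrightarrow{b}_{C,A,B}c_{A\cdot B,C}\overrightarrow{b}_{A,B,C}=(c_{A,C}\cdot 1_B)\overrightarrow{b}_{A,C,B}(1_A\cdot c_{B,C})$. It is *relevant* if moreover it has special arrows $w_A:A\to A\cdot A$ with: $(f\cdot f)w_A=w_Bf$ for $f:A\to B$; $\sigma_{\mathrm I}w_{\mathrm I}=1_{\mathrm I}$; $\overrightarrow{b}_{A,A,A}(1_A\cdot w_A)w_A=(w_A\cdot 1_A)w_A$; $c_{A,A}w_A=w_A$; $c^m_{A,B,A,B}w_{A\cdot B}=w_A\cdot w_B$, where $c^m_{A,B,C,D}=\overrightarrow{b}_{A,C,B\cdot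 D}(1_A\cdot(\overleftarrow{b}_{C,B,D}(c_{B,C}\cdot 1_D)\overrightarrow{b}_{B,C,D}))\overleftarrow{b}_{A,B,C\cdot D}$. **Shapes.** Shapes are terms built from the symbols $\Box$ and $\mathrm I$ by the binary operation $\cdot$. A shape with $m$ occurrences of $\Box$ (arity $m\ge 0$) defines a functor $\mathcal A^m\to\mathcal A$ by putting the arguments, in order, in place of the boxes ($\Box$ gives the identity functor, $\mathrm I$ the constant $\mathrm I$, and $(F\cdot G)(A_1,\dots,A_{m+n})=F(A_1,\dots,A_m)\cdot G(A_{m+1},\dots,A_{m+n})$). A shape and its functor are denoted by the same letter. **Canonical transformations.** For shapes $F,G$ of arities $m,n$, a canonical transformation $\alpha:F\to G$ with graph $\Gamma:\{1,\dots,n\}\to\{1,\dots,m\}$ is a family of arrows $\alpha(A_1,\dots,A_m):F(A_1,\dots,A_m)\to G(A_{\Gamma(1)},\dots,A_{\Gamma(n)})$, indexed by $(A_1,\dots,A_m)\in\mathcal A^m$, obtained inductively as follows ($F,G,H$ have arities $m,n,l$). (i) Primitive ones (components are the corresponding special arrows indexed by values of the functors): $1_F:F\to F$, $\sigma_F:\mathrm I\cdot F\to F$, $\sigma^i_F:F\to\mathrm I\cdot F$, $\delta_F:F\cdot\mathrm I\to F$, $\delta^i_F:F\to F\cdot\mathrm I$, $\overrightarrow{b}_{F,G,H}:F\cdot(G\cdot H)\to(F\cdot G)\cdot H$, $\overleftarrow{b}_{F,G,H}:(F\cdot G)\cdot H\to F\cdot(G\cdot H)$, all with identity functions as graphs;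 $c_{F,G}:F\cdot G\to G\cdot F$ with graph $\Gamma(i)=m+i$ for $1\le i\le n$, $\Gamma(n+j)=j$ for $1\le j\le m$; $w_F:F\to F\cdot F$ with graph $\Gamma(i)=\Gamma(m+i)=i$ for $1\le i\le m$. (ii) If $\alpha:F_1\to G_1$ has graph $\Phi$, $\beta:F_2\to G_2$ has graph $\Psi$, and $F_1,F_2,G_1,G_2$ have arities $m,n,k,l$, then $\alpha\cdot\beta:F_1\cdot F_2\to G_1\cdot G_2$, with components $\alpha(A_1,\dots,A_m)\cdot\beta(A_{m+1},\dots,A_{m+n})$, is canonical with graph $\Gamma(i)=\Phi(i)$ for $1\le i\le k$, $\Gamma(k+j)=m+\Psi(j)$ for $1\le j\le l$. (iii) If $\alpha:F\to G$ has graph $\Phi:\{1,\dots,n\}\to\{1,\dots,m\}$ and $\beta:G\to H$ has graph $\Psi:\{1,\dots,l\}\to\{1,\dots,n\}$, then $\beta\alpha:F\to H$, with components $\beta(A_{\Phi(1)},\dots,A_{\Phi(n)})\,\alpha(A_1,\dots,A_m)$, is canonical with graph $i\mapsto\Phi(\Psi(i))$. *)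

theory Defs
  imports Main "HOL-Library.FuncSet"
begin

section \<open>Relevant categories\<close>

record ('o, 'a) category =
  Obj :: "'o set"
  Arr :: "'a set"
  Dom :: "'a \<Rightarrow> 'o"
  Cod :: "'a \<Rightarrow> 'o"
  Id :: "'o \<Rightarrow> 'a" ("\<one>\<index>")
  Comp :: "'a \<Rightarrow> 'a \<Rightarrow> 'a" (infixr "\<bullet>\<index>" 65)

definition hom :: "('o, 'a, 'z) category_scheme \<Rightarrow> 'o \<Rightarrow> 'o \<Rightarrow> 'a set" where
  "hom C A B = {f \<in> Arr C. Dom C f = A \<and> Cod C f = B}"

text \<open>
  Composition is written in the order of application: for \<open>f : A \<rightarrow> B\<close> and \<open>g : B \<rightarrow> D\<close> the
  composite is \<open>g \<bullet> f : A \<rightarrow> D\<close>.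
\<close>

locale category =
  fixes C :: "('o, 'a, 'z) category_scheme" (structure)
  assumes dom_closed: "f \<in> Arr C \<Longrightarrow> Dom C f \<in> Obj C"
    and cod_closed: "f \<in> Arr C \<Longrightarrow> Cod C f \<in> Obj C"
    and id_hom: "A \<in> Obj C \<Longrightarrow> \<one> A \<in> hom C A A"
    and comp_hom: "f \<in> hom C A B \<Longrightarrow> g \<in> hom C B D \<Longrightarrow> g \<bullet> f \<in> hom C A D"
    and comp_id_right: "f \<in> hom C A B \<Longrightarrow> f \<bullet> \<one> A = f"
    and comp_id_left: "f \<in> hom C A B \<Longrightarrow> \<one> B \<bullet> f = f"
    and comp_assoc:
      "f \<in> hom C A B \<Longrightarrow> g \<in> hom C B D \<Longrightarrow> h \<in> hom C D E \<Longrightarrow> (h \<bullet> g) \<bullet> f = h \<bullet> (g \<bullet> f)"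

text \<open>
  The multiplication bifunctor acts as \<open>\<odot>\<close> on objects and as \<open>\<otimes>\<close> on arrows.
\<close>

record ('o, 'a) mult_category = "('o, 'a) category" +
  unit_obj :: "'o" ("\<I>\<index>")
  mult_obj :: "'o \<Rightarrow> 'o \<Rightarrow> 'o" (infixr "\<odot>\<index>" 75)
  mult_arr :: "'a \<Rightarrow> 'a \<Rightarrow> 'a" (infixr "\<otimes>\<index>" 75)

locale mult_category = category C
  for C :: "('o, 'a, 'z) mult_category_scheme" (structure) +
  assumes unit_obj_closed: "\<I> \<in> Obj C"
    and mult_obj_closed: "A \<in> Obj C \<Longrightarrow> B \<in> Obj C \<Longrightarrow> A \<odot> B \<in> Obj C"
    and mult_arr_hom:
      "f \<in> hom C A D \<Longrightarrow> g \<in> hom C B E \<Longrightarrow> f \<otimes> g \<in> hom C (A \<odot> B) (D \<odot> E)"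
    and mult_id: "A \<in> Obj C \<Longrightarrow> B \<in> Obj C \<Longrightarrow> \<one> A \<otimes> \<one> B = \<one> (A \<odot> B)"
    and mult_comp:
      "f \<in> hom C A B \<Longrightarrow> f' \<in> hom C B D \<Longrightarrow> g \<in> hom C A' B' \<Longrightarrow> g' \<in> hom C B' D' \<Longrightarrow>
        (f' \<bullet> f) \<otimes> (g' \<bullet> g) = (f' \<otimes> g') \<bullet> (f \<otimes> g)"

record ('o, 'a) monoidal_category = "('o, 'a) mult_category" +
  sigma :: "'o \<Rightarrow> 'a" ("\<sigma>\<index>")
  sigma_inv :: "'o \<Rightarrow> 'a" ("\<sigma>\<^sup>i\<index>")
  delta :: "'o \<Rightarrow> 'a" ("\<delta>\<index>")
  delta_inv :: "'o \<Rightarrow> 'a" ("\<delta>\<^sup>i\<index>")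
  b_right :: "'o \<Rightarrow> 'o \<Rightarrow> 'o \<Rightarrow> 'a" ("\<b>\<^sup>\<rightarrow>\<index>")
  b_left :: "'o \<Rightarrow> 'o \<Rightarrow> 'o \<Rightarrow> 'a" ("\<b>\<^sup>\<leftarrow>\<index>")

locale monoidal_category = mult_category C
  for C :: "('o, 'a, 'z) monoidal_category_scheme" (structure) +
  assumes sigma_hom: "A \<in> Obj C \<Longrightarrow> \<sigma> A \<in> hom C (\<I> \<odot> A) A"
    and sigma_inv_hom: "A \<in> Obj C \<Longrightarrow> \<sigma>\<^sup>i A \<in> hom C A (\<I> \<odot> A)"
    and delta_hom: "A \<in> Obj C \<Longrightarrow> \<delta> A \<in> hom C (A \<odot> \<I>) A"
    and delta_inv_hom: "A \<in> Obj C \<Longrightarrow> \<delta>\<^sup>i A \<in> hom C A (A \<odot> \<I>)"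
    and b_right_hom:
      "A \<in> Obj C \<Longrightarrow> B \<in> Obj C \<Longrightarrow> D \<in> Obj C \<Longrightarrow>
        \<b>\<^sup>\<rightarrow> A B D \<in> hom C (A \<odot> (B \<odot> D)) ((A \<odot> B) \<odot> D)"
    and b_left_hom:
      "A \<in> Obj C \<Longrightarrow> B \<in> Obj C \<Longrightarrow> D \<in> Obj C \<Longrightarrow>
        \<b>\<^sup>\<leftarrow> A B D \<in> hom C ((A \<odot> B) \<odot> D) (A \<odot> (B \<odot> D))"
    and sigma_natural: "f \<in> hom C A B \<Longrightarrow> f \<bullet> \<sigma> A = \<sigma> B \<bullet> (\<one> \<I> \<otimes> f)"
    and delta_natural: "f \<in> hom C A B \<Longrightarrow> f \<bullet> \<delta> A = \<delta> B \<bullet> (f \<otimes> \<one> \<I>)"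
    and sigma_sigma_inv: "A \<in> Obj C \<Longrightarrow> \<sigma> A \<bullet> \<sigma>\<^sup>i A = \<one> A"
    and sigma_inv_sigma: "A \<in> Obj C \<Longrightarrow> \<sigma>\<^sup>i A \<bullet> \<sigma> A = \<one> (\<I> \<odot> A)"
    and delta_delta_inv: "A \<in> Obj C \<Longrightarrow> \<delta> A \<bullet> \<delta>\<^sup>i A = \<one> A"
    and delta_inv_delta: "A \<in> Obj C \<Longrightarrow> \<delta>\<^sup>i A \<bullet> \<delta> A = \<one> (A \<odot> \<I>)"
    and sigma_unit: "\<sigma> \<I> = \<delta> \<I>"
    and b_right_natural:
      "f \<in> hom C A D \<Longrightarrow> g \<in> hom C B E \<Longrightarrow> h \<in> hom C B' E' \<Longrightarrow>
        ((f \<otimes> g) \<otimes> h) \<bullet> \<b>\<^sup>\<rightarrow> A B B' = \<b>\<^sup>\<rightarrow> D E E' \<bullet> (f \<otimes> (g \<otimes> h))"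
    and b_right_left:
      "A \<in> Obj C \<Longrightarrow> B \<in> Obj C \<Longrightarrow> D \<in> Obj C \<Longrightarrow>
        \<b>\<^sup>\<rightarrow> A B D \<bullet> \<b>\<^sup>\<leftarrow> A B D = \<one> ((A \<odot> B) \<odot> D)"
    and b_left_right:
      "A \<in> Obj C \<Longrightarrow> B \<in> Obj C \<Longrightarrow> D \<in> Obj C \<Longrightarrow>
        \<b>\<^sup>\<leftarrow> A B D \<bullet> \<b>\<^sup>\<rightarrow> A B D = \<one> (A \<odot> (B \<odot> D))"
    and triangle:
      "A \<in> Obj C \<Longrightarrow> B \<in> Obj C \<Longrightarrow> (\<delta> A \<otimes> \<one> B) \<bullet> \<b>\<^sup>\<rightarrow> A \<I> B = \<one> A \<otimes> \<sigma> B"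
    and pentagon:
      "A \<in> Obj C \<Longrightarrow> B \<in> Obj C \<Longrightarrow> D \<in> Obj C \<Longrightarrow> E \<in> Obj C \<Longrightarrow>
        \<b>\<^sup>\<rightarrow> (A \<odot> B) D E \<bullet> \<b>\<^sup>\<rightarrow> A B (D \<odot> E) =
        (\<b>\<^sup>\<rightarrow> A B D \<otimes> \<one> E) \<bullet> \<b>\<^sup>\<rightarrow> A (B \<odot> D) E \<bullet> (\<one> A \<otimes> \<b>\<^sup>\<rightarrow> B D E)"

record ('o, 'a) symmetric_monoidal_category = "('o, 'a) monoidal_category" +
  sym_arr :: "'o \<Rightarrow> 'o \<Rightarrow> 'a" ("\<c>\<index>")

locale symmetric_monoidal_category = monoidal_category C
  for C :: "('o, 'a, 'z) symmetric_monoidal_category_scheme" (structure) +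
  assumes sym_hom: "A \<in> Obj C \<Longrightarrow> B \<in> Obj C \<Longrightarrow> \<c> A B \<in> hom C (A \<odot> B) (B \<odot> A)"
    and sym_natural:
      "f \<in> hom C A D \<Longrightarrow> g \<in> hom C B E \<Longrightarrow> (g \<otimes> f) \<bullet> \<c> A B = \<c> D E \<bullet> (f \<otimes> g)"
    and sym_sym: "A \<in> Obj C \<Longrightarrow> B \<in> Obj C \<Longrightarrow> \<c> B A \<bullet> \<c> A B = \<one> (A \<odot> B)"
    and sigma_sym: "A \<in> Obj C \<Longrightarrow> \<sigma> A \<bullet> \<c> A \<I> = \<delta> A"
    and hexagon:
      "A \<in> Obj C \<Longrightarrow> B \<in> Obj C \<Longrightarrow> D \<in> Obj C \<Longrightarrow>
        \<b>\<^sup>\<rightarrow> D A B \<bullet> \<c> (A \<odot> B) D \<bullet> \<b>\<^sup>\<rightarrow> A B D =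
        (\<c> A D \<otimes> \<one> B) \<bullet> \<b>\<^sup>\<rightarrow> A D B \<bullet> (\<one> A \<otimes> \<c> B D)"

definition middle_sym ::
    "('o, 'a, 'z) symmetric_monoidal_category_scheme \<Rightarrow> 'o \<Rightarrow> 'o \<Rightarrow> 'o \<Rightarrow> 'o \<Rightarrow> 'a"
    ("\<c>\<^sup>m\<index>") where
  "\<c>\<^sup>m\<^bsub>C\<^esub> A B D E =
    \<b>\<^sup>\<rightarrow>\<^bsub>C\<^esub> A D (B \<odot>\<^bsub>C\<^esub> E) \<bullet>\<^bsub>C\<^esub>
    (\<one>\<^bsub>C\<^esub> A \<otimes>\<^bsub>C\<^esub>
      (\<b>\<^sup>\<leftarrow>\<^bsub>C\<^esub> D B E \<bullet>\<^bsub>C\<^esub> (\<c>\<^bsub>C\<^esub> B D \<otimes>\<^bsub>C\<^esub> \<one>\<^bsub>C\<^esub> E) \<bullet>\<^bsub>C\<^esub> \<b>\<^sup>\<rightarrow>\<^bsub>C\<^esub> B D E)) \<bullet>\<^bsub>C\<^esub>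
    \<b>\<^sup>\<leftarrow>\<^bsub>C\<^esub> A B (D \<odot>\<^bsub>C\<^esub> E)"

record ('o, 'a) relevant_category = "('o, 'a) symmetric_monoidal_category" +
  diag_arr :: "'o \<Rightarrow> 'a" ("\<w>\<index>")

locale relevant_category = symmetric_monoidal_category C
  for C :: "('o, 'a, 'z) relevant_category_scheme" (structure) +
  assumes diag_hom: "A \<in> Obj C \<Longrightarrow> \<w> A \<in> hom C A (A \<odot> A)"
    and diag_natural: "f \<in> hom C A B \<Longrightarrow> (f \<otimes> f) \<bullet> \<w> A = \<w> B \<bullet> f"
    and sigma_diag_unit: "\<sigma> \<I> \<bullet> \<w> \<I> = \<one> \<I>"
    and diag_assoc:
      "A \<in> Obj C \<Longrightarrow> \<b>\<^sup>\<rightarrow> A A A \<bullet> (\<one> A \<otimes> \<w> A) \<bullet> \<w> A = (\<w> A \<otimes> \<one> A) \<bullet> \<w> A"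
    and sym_diag: "A \<in> Obj C \<Longrightarrow> \<c> A A \<bullet> \<w> A = \<w> A"
    and diag_mult:
      "A \<in> Obj C \<Longrightarrow> B \<in> Obj C \<Longrightarrow> \<c>\<^sup>m A B A B \<bullet> \<w> (A \<odot> B) = \<w> A \<otimes> \<w> B"

section \<open>Shapes\<close>

datatype shape = Box ("\<box>") | Unit | Mult shape shape (infixr "\<boxdot>" 75)

primrec arity :: "shape \<Rightarrow> nat" where
  "arity \<box> = 1"
| "arity Unit = 0"
| "arity (F \<boxdot> G) = arity F + arity G"

text \<open>
  An \<open>m\<close>-tuple of objects is an extensional function on \<open>{1..m}\<close>, and \<open>slice k n A\<close> is the tuple
  \<open>(A\<^sub>k\<^sub>+\<^sub>1, \<dots>, A\<^sub>k\<^sub>+\<^sub>n)\<close>.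
\<close>

definition tuples :: "('o, 'a, 'z) category_scheme \<Rightarrow> nat \<Rightarrow> (nat \<Rightarrow> 'o) set" where
  "tuples C m = {1..m} \<rightarrow>\<^sub>E Obj C"

definition slice :: "nat \<Rightarrow> nat \<Rightarrow> (nat \<Rightarrow> 'o) \<Rightarrow> nat \<Rightarrow> 'o" where
  "slice k n A = (\<lambda>i\<in>{1..n}. A (k + i))"

text \<open>The object part of the functor that a shape defines.\<close>

primrec shape_obj ::
    "('o, 'a, 'z) mult_category_scheme \<Rightarrow> shape \<Rightarrow> (nat \<Rightarrow> 'o) \<Rightarrow> 'o" where
  "shape_obj C \<box> A = A 1"
| "shape_obj C Unit A = \<I>\<^bsub>C\<^esub>"
| "shape_obj C (F \<boxdot> G) A =
    shape_obj C F (slice 0 (arity F) A) \<odot>\<^bsub>C\<^esub> shape_obj C G (slice (arity F) (arity G) A)"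

section \<open>Canonical transformations\<close>

definition id_graph :: "nat \<Rightarrow> nat \<Rightarrow> nat" where
  "id_graph m = (\<lambda>i\<in>{1..m}. i)"

definition swap_graph :: "nat \<Rightarrow> nat \<Rightarrow> nat \<Rightarrow> nat" where
  "swap_graph m n = (\<lambda>i\<in>{1..n + m}. if i \<le> n then m + i else i - n)"

definition diag_graph :: "nat \<Rightarrow> nat \<Rightarrow> nat" where
  "diag_graph m = (\<lambda>i\<in>{1..m + m}. if i \<le> m then i else i - m)"

text \<open>The graph of a product, for \<open>\<Phi> : {1..k} \<rightarrow> {1..m}\<close> and \<open>\<Psi>\<close> with domain \<open>{1..l}\<close>.\<close>

definition mult_graph ::
    "nat \<Rightarrow> nat \<Rightarrow> nat \<Rightarrow> (nat \<Rightarrow> nat) \<Rightarrow> (nat \<Rightarrow> nat) \<Rightarrow> nat \<Rightarrow> nat" where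
  "mult_graph m k l \<Phi> \<Psi> = (\<lambda>i\<in>{1..k + l}. if i \<le> k then \<Phi> i else m + \<Psi> (i - k))"

text \<open>
  \<open>canonical C F G \<Gamma> \<alpha>\<close> says that the family \<open>\<alpha>\<close>, indexed by the \<open>arity F\<close>-tuples of objects, is a
  canonical transformation from \<open>F\<close> to \<open>G\<close> with graph \<open>\<Gamma> : {1..arity G} \<rightarrow> {1..arity F}\<close>. Graphs and
  families are extensional functions, so that HOL equality is equality of functions on
  \<open>{1..arity G}\<close> and of families of arrows. The tuple \<open>(A\<^bsub>\<Gamma>(1)\<^esub>, \<dots>, A\<^bsub>\<Gamma>(n)\<^esub>)\<close> is \<open>compose {1..n} A \<Gamma>\<close>.
\<close>

inductive canonical ::
    "('o, 'a, 'z) relevant_category_scheme \<Rightarrow> shape \<Rightarrow> shape \<Rightarrow> (nat \<Rightarrow> nat) \<Rightarrow>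
      ((nat \<Rightarrow> 'o) \<Rightarrow> 'a) \<Rightarrow> bool"
  for C :: "('o, 'a, 'z) relevant_category_scheme"
where
  canonical_id:
    "canonical C F F (id_graph (arity F))
      (\<lambda>A\<in>tuples C (arity F). \<one>\<^bsub>C\<^esub> (shape_obj C F A))"
| canonical_sigma:
    "canonical C (Unit \<boxdot> F) F (id_graph (arity F))
      (\<lambda>A\<in>tuples C (arity F). \<sigma>\<^bsub>C\<^esub> (shape_obj C F A))"
| canonical_sigma_inv:
    "canonical C F (Unit \<boxdot> F) (id_graph (arity F))
      (\<lambda>A\<in>tuples C (arity F). \<sigma>\<^sup>i\<^bsub>C\<^esub> (shape_obj C F A))"
| canonical_delta:
    "canonical C (F \<boxdot> Unit) F (id_graph (arity F))
      (\<lambda>A\<in>tuples C (arity F). \<delta>\<^bsub>C\<^esub> (shape_obj C F A))"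
| canonical_delta_inv:
    "canonical C F (F \<boxdot> Unit) (id_graph (arity F))
      (\<lambda>A\<in>tuples C (arity F). \<delta>\<^sup>i\<^bsub>C\<^esub> (shape_obj C F A))"
| canonical_b_right:
    "canonical C (F \<boxdot> (G \<boxdot> H)) ((F \<boxdot> G) \<boxdot> H) (id_graph (arity F + arity G + arity H))
      (\<lambda>A\<in>tuples C (arity F + arity G + arity H).
        \<b>\<^sup>\<rightarrow>\<^bsub>C\<^esub> (shape_obj C F (slice 0 (arity F) A))
          (shape_obj C G (slice (arity F) (arity G) A))
          (shape_obj C H (slice (arity F + arity G) (arity H) A)))"
| canonical_b_left:
    "canonical C ((F \<boxdot> G) \<boxdot> H) (F \<boxdot> (G \<boxdot> H)) (id_graph (arity F + arity G + arity H))
      (\<lambda>A\<in>tuples C (arity F + arity G + arity H).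
        \<b>\<^sup>\<leftarrow>\<^bsub>C\<^esub> (shape_obj C F (slice 0 (arity F) A))
          (shape_obj C G (slice (arity F) (arity G) A))
          (shape_obj C H (slice (arity F + arity G) (arity H) A)))"
| canonical_sym:
    "canonical C (F \<boxdot> G) (G \<boxdot> F) (swap_graph (arity F) (arity G))
      (\<lambda>A\<in>tuples C (arity F + arity G).
        \<c>\<^bsub>C\<^esub> (shape_obj C F (slice 0 (arity F) A))
          (shape_obj C G (slice (arity F) (arity G) A)))"
| canonical_diag:
    "canonical C F (F \<boxdot> F) (diag_graph (arity F))
      (\<lambda>A\<in>tuples C (arity F). \<w>\<^bsub>C\<^esub> (shape_obj C F A))"
| canonical_mult:
    "canonical C F\<^sub>1 G\<^sub>1 \<Phi> \<alpha> \<Longrightarrow> canonical C F\<^sub>2 G\<^sub>2 \<Psi> \<beta> \<Longrightarrow>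
      canonical C (F\<^sub>1 \<boxdot> F\<^sub>2) (G\<^sub>1 \<boxdot> G\<^sub>2)
        (mult_graph (arity F\<^sub>1) (arity G\<^sub>1) (arity G\<^sub>2) \<Phi> \<Psi>)
        (\<lambda>A\<in>tuples C (arity F\<^sub>1 + arity F\<^sub>2).
          \<alpha> (slice 0 (arity F\<^sub>1) A) \<otimes>\<^bsub>C\<^esub> \<beta> (slice (arity F\<^sub>1) (arity F\<^sub>2) A))"
| canonical_comp:
    "canonical C F G \<Phi> \<alpha> \<Longrightarrow> canonical C G H \<Psi> \<beta> \<Longrightarrow>
      canonical C F H (compose {1..arity H} \<Phi> \<Psi>)
        (\<lambda>A\<in>tuples C (arity F). \<beta> (compose {1..arity G} A \<Phi>) \<bullet>\<^bsub>C\<^esub> \<alpha> A)"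

end

theory Submission
  imports Defs
begin

text \<open>
  Fix objects \<open>X k\<close> for variables \<open>k < n\<close>. For a set \<open>S\<close> of variables let \<open>P S\<close> be the product of
  the \<open>X k\<close> with \<open>k \<in> S\<close>. The diagonals and symmetries give arrows \<open>P (S \<union> T) \<rightarrow> P S \<odot> P T\<close> which are
  coassociative, symmetric, unital, and equal to the diagonal of \<open>P S\<close> if \<open>S = T\<close>. By recursion on a
  shape whose boxes are labelled with variables, they give an arrow from \<open>P S\<close> to the value of the
  shape, where \<open>S\<close> is the set of labels. As there are no projections, a canonical
  transformation preserves the set of labels, and the properties above say exactly that the primitive
  ones carry the arrow of the source to the arrow of the target; products and composites follow
  at once. If the labels of the source are distinct, its arrow has a section, so that the canonical
  transformation is determined by the relabelling of the target, that is, by its graph.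
\<close>

section \<open>Arrows with explicit domain and codomain\<close>

text \<open>No coherence theorem for monoidal or symmetric monoidal categories is presupposed; only
  the finitely many diagrams that the splitting arrows require are checked. The obstacle is that
  \<open>w\<close> need not be invertible. A shape with repeated labels therefore cannot be
  conjugated to a normal form, and the invariant has to be covariant: a transformation composed with
  the arrow of its source equals the arrow of its target. Inverting is done once, at the end, on a
  source whose labels are distinct. The induction must nevertheless range over all labellings,
  because the intermediate shapes of a composite repeat labels. Each axiom on \<open>w\<close> has
  its task: \<open>diag_assoc\<close> gives coassociativity for one variable and
  \<open>sym_diag\<close> symmetry; \<open>diag_mult\<close> passes from one variable to a product;
  \<open>sigma_diag_unit\<close> identifies the diagonal of \<I> with the inverse unit arrow, so
  that absent variables obey the same laws as present ones; \<open>diag_natural\<close> handles the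
  primitive transformation \<open>w\<close> itself.\<close>

context category
begin

lemma Id_arr [simp]:
  assumes "A \<in> Obj C"
  shows "\<one> A \<in> Arr C" "Dom C (\<one> A) = A" "Cod C (\<one> A) = A"
  using id_hom[OF assms] by (auto simp: hom_def)

lemma Comp_arr [simp]:
  assumes "f \<in> Arr C" "g \<in> Arr C" "Cod C f = Dom C g"
  shows "g \<bullet> f \<in> Arr C" "Dom C (g \<bullet> f) = Dom C f" "Cod C (g \<bullet> f) = Cod C g"
  using comp_hom[of f "Dom C f" "Cod C f" g "Cod C g"] assms by (auto simp: hom_def)

lemma Comp_Id [simp]:
  "f \<in> Arr C \<Longrightarrow> Dom C f = A \<Longrightarrow> f \<bullet> \<one> A = f"
  "f \<in> Arr C \<Longrightarrow> Cod C f = A \<Longrightarrow> \<one> A \<bullet> f = f"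
  using comp_id_right[of f A "Cod C f"] comp_id_left[of f "Dom C f" A] by (auto simp: hom_def)

lemma Comp_assoc [simp]:
  assumes "f \<in> Arr C" "g \<in> Arr C" "h \<in> Arr C" "Cod C f = Dom C g" "Cod C g = Dom C h"
  shows "(h \<bullet> g) \<bullet> f = h \<bullet> g \<bullet> f"
  using comp_assoc[of f "Dom C f" "Cod C f" g "Cod C g" h "Cod C h"] assms by (auto simp: hom_def)

text \<open>Composites are kept bracketed to the right, so the left side of an equation
  \<open>g \<bullet> f = k\<close> does not occur literally when further arrows are applied before
  \<open>f\<close>. This supplies the version with a tail \<open>x\<close>.\<close>

lemma Comp_reassoc:
  assumes "g \<bullet> f = k" "f \<in> Arr C" "g \<in> Arr C" "Cod C f = Dom C g"
    "x \<in> Arr C" "Cod C x = Dom C f"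
  shows "g \<bullet> f \<bullet> x = k \<bullet> x"
  using Comp_assoc[of x f g] assms by simp

lemma Dom_Obj [simp]: "f \<in> Arr C \<Longrightarrow> Dom C f \<in> Obj C"
  and Cod_Obj [simp]: "f \<in> Arr C \<Longrightarrow> Cod C f \<in> Obj C"
  by (simp_all add: dom_closed cod_closed)

lemma epi_cancel:
  assumes "f \<bullet> u = g \<bullet> u" "u \<bullet> u' = \<one> A" "f \<in> Arr C" "g \<in> Arr C" "u \<in> Arr C" "u' \<in> Arr C"
    "Dom C f = A" "Dom C g = A" "Cod C u = A" "Cod C u' = Dom C u"
  shows "f = g"
proof -
  have "f = f \<bullet> u \<bullet> u'" by (simp add: assms(2-))
  also have "\<dots> = (f \<bullet> u) \<bullet> u'" by (simp add: assms(2-))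
  also have "\<dots> = g \<bullet> u \<bullet> u'" unfolding assms(1) by (simp add: assms(2-))
  also have "\<dots> = g" by (simp add: assms(2-))
  finally show ?thesis .
qed

lemma mono_cancel:
  assumes "u \<bullet> f = u \<bullet> g" "u' \<bullet> u = \<one> A" "f \<in> Arr C" "g \<in> Arr C" "u \<in> Arr C" "u' \<in> Arr C"
    "Cod C f = A" "Cod C g = A" "Dom C u = A" "Dom C u' = Cod C u"
  shows "f = g"
proof -
  have "f = (u' \<bullet> u) \<bullet> f" using assms(2-) by simp
  also have "\<dots> = u' \<bullet> u \<bullet> f" by (rule Comp_assoc) (simp_all add: assms(3-))
  also have "\<dots> = (u' \<bullet> u) \<bullet> g"
    unfolding assms(1) by (rule Comp_assoc[symmetric]) (simp_all add: assms(3-))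
  also have "\<dots> = g" using assms(2-) by simp
  finally show ?thesis .
qed

text \<open>A right inverse is what cancellation in \<open>f \<bullet> u = g \<bullet> u\<close>
  uses, and the property passes to composites and products, which is how \<open>expand\<close> is
  built.\<close>

definition has_section :: "'a \<Rightarrow> bool" where
  "has_section f \<longleftrightarrow> f \<in> Arr C \<and>
    (\<exists>g. g \<in> Arr C \<and> Dom C g = Cod C f \<and> Cod C g = Dom C f \<and> f \<bullet> g = \<one> (Cod C f))"

lemma has_sectionI:
  assumes "f \<bullet> g = \<one> (Cod C f)" "f \<in> Arr C" "g \<in> Arr C" "Dom C g = Cod C f" "Cod C g = Dom C f"
  shows "has_section f"
  using assms by (auto simp: has_section_def)

lemma has_section_Id: "A \<in> Obj C \<Longrightarrow> has_section (\<one> A)"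
  by (rule has_sectionI[of _ "\<one> A"]) simp_all

lemma has_section_Comp:
  assumes "has_section f" "has_section g" "Cod C f = Dom C g"
  shows "has_section (g \<bullet> f)"
proof -
  obtain f' where f: "f \<in> Arr C" "f' \<in> Arr C" "Dom C f' = Cod C f" "Cod C f' = Dom C f" "f \<bullet> f' = \<one> (Cod C f)"
    using assms(1) by (auto simp: has_section_def)
  obtain g' where g: "g \<in> Arr C" "g' \<in> Arr C" "Dom C g' = Cod C g" "Cod C g' = Dom C g" "g \<bullet> g' = \<one> (Cod C g)"
    using assms(2) by (auto simp: has_section_def)
  show ?thesis
    by (rule has_sectionI[of _ "f' \<bullet> g'"]) (simp_all add: f g assms(3) Comp_reassoc[OF f(5)])
qed

lemma has_section_cancel:
  assumes "has_section u" "f \<bullet> u = g \<bullet> u" "f \<in> Arr C" "g \<in> Arr C" "Dom C f = Cod C u" "Dom C g = Cod C u"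
  shows "f = g"
proof -
  obtain u' where u: "u \<in> Arr C" "u' \<in> Arr C" "Dom C u' = Cod C u" "Cod C u' = Dom C u" "u \<bullet> u' = \<one> (Cod C u)"
    using assms(1) by (auto simp: has_section_def)
  show ?thesis by (rule epi_cancel[OF assms(2) u(5)]) (simp_all add: assms u)
qed

end

context mult_category
begin

declare unit_obj_closed [simp] mult_obj_closed [simp] mult_id [simp]

lemma Mult_arr [simp]:
  assumes "f \<in> Arr C" "g \<in> Arr C"
  shows "f \<otimes> g \<in> Arr C" "Dom C (f \<otimes> g) = Dom C f \<odot> Dom C g" "Cod C (f \<otimes> g) = Cod C f \<odot> Cod C g"
  using mult_arr_hom[of f "Dom C f" "Cod C f" g "Dom C g" "Cod C g"] assms by (auto simp: hom_def)

lemma Mult_Comp [simp]: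
  assumes "f \<in> Arr C" "f' \<in> Arr C" "g \<in> Arr C" "g' \<in> Arr C"
    "Cod C f = Dom C f'" "Cod C g = Dom C g'"
  shows "(f' \<otimes> g') \<bullet> (f \<otimes> g) = (f' \<bullet> f) \<otimes> (g' \<bullet> g)"
  using mult_comp[of f "Dom C f" "Cod C f" f' "Cod C f'" g "Dom C g" "Cod C g" g' "Cod C g'"] assms
  by (auto simp: hom_def)

lemma Mult_Comp_Comp [simp]:
  assumes "f \<in> Arr C" "f' \<in> Arr C" "g \<in> Arr C" "g' \<in> Arr C" "x \<in> Arr C"
    "Cod C f = Dom C f'" "Cod C g = Dom C g'" "Cod C x = Dom C f \<odot> Dom C g"
  shows "(f' \<otimes> g') \<bullet> (f \<otimes> g) \<bullet> x = ((f' \<bullet> f) \<otimes> (g' \<bullet> g)) \<bullet> x"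
  using assms by (simp add: Comp_reassoc[OF Mult_Comp])

lemma has_section_Mult:
  assumes "has_section f" "has_section g"
  shows "has_section (f \<otimes> g)"
proof -
  obtain f' where f: "f \<in> Arr C" "f' \<in> Arr C" "Dom C f' = Cod C f" "Cod C f' = Dom C f" "f \<bullet> f' = \<one> (Cod C f)"
    using assms(1) by (auto simp: has_section_def)
  obtain g' where g: "g \<in> Arr C" "g' \<in> Arr C" "Dom C g' = Cod C g" "Cod C g' = Dom C g" "g \<bullet> g' = \<one> (Cod C g)"
    using assms(2) by (auto simp: has_section_def)
  show ?thesis
    by (rule has_sectionI[of _ "f' \<otimes> g'"]) (simp_all add: f g)
qed

end

section \<open>Monoidal categories\<close>

context monoidal_category
begin

abbreviation (input) "br \<equiv> b_right C"
abbreviation (input) "bl \<equiv> b_left C"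

lemma sigma_arr [simp]:
  assumes "A \<in> Obj C"
  shows "\<sigma> A \<in> Arr C" "Dom C (\<sigma> A) = \<I> \<odot> A" "Cod C (\<sigma> A) = A"
    "\<sigma>\<^sup>i A \<in> Arr C" "Dom C (\<sigma>\<^sup>i A) = A" "Cod C (\<sigma>\<^sup>i A) = \<I> \<odot> A"
  using sigma_hom[OF assms] sigma_inv_hom[OF assms] by (auto simp: hom_def)

lemma delta_arr [simp]:
  assumes "A \<in> Obj C"
  shows "\<delta> A \<in> Arr C" "Dom C (\<delta> A) = A \<odot> \<I>" "Cod C (\<delta> A) = A"
    "\<delta>\<^sup>i A \<in> Arr C" "Dom C (\<delta>\<^sup>i A) = A" "Cod C (\<delta>\<^sup>i A) = A \<odot> \<I>"
  using delta_hom[OF assms] delta_inv_hom[OF assms] by (auto simp: hom_def)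

lemma b_arr [simp]:
  assumes "A \<in> Obj C" "B \<in> Obj C" "D \<in> Obj C"
  shows "br A B D \<in> Arr C" "Dom C (br A B D) = A \<odot> B \<odot> D" "Cod C (br A B D) = (A \<odot> B) \<odot> D"
    "bl A B D \<in> Arr C" "Dom C (bl A B D) = (A \<odot> B) \<odot> D" "Cod C (bl A B D) = A \<odot> B \<odot> D"
  using b_right_hom[OF assms] b_left_hom[OF assms] by (auto simp: hom_def)

declare sigma_sigma_inv [simp] sigma_inv_sigma [simp] delta_delta_inv [simp] delta_inv_delta [simp]
  b_right_left [simp] b_left_right [simp]

lemma unit_inverse_Comp [simp]:
  assumes "f \<in> Arr C" "A \<in> Obj C"
  shows "Cod C f = A \<Longrightarrow> \<sigma> A \<bullet> \<sigma>\<^sup>i A \<bullet> f = f"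
    "Cod C f = \<I> \<odot> A \<Longrightarrow> \<sigma>\<^sup>i A \<bullet> \<sigma> A \<bullet> f = f"
    "Cod C f = A \<Longrightarrow> \<delta> A \<bullet> \<delta>\<^sup>i A \<bullet> f = f"
    "Cod C f = A \<odot> \<I> \<Longrightarrow> \<delta>\<^sup>i A \<bullet> \<delta> A \<bullet> f = f"
  using assms by (simp_all add: Comp_reassoc[OF sigma_sigma_inv] Comp_reassoc[OF sigma_inv_sigma]
      Comp_reassoc[OF delta_delta_inv] Comp_reassoc[OF delta_inv_delta])

lemma b_inverse_Comp [simp]:
  assumes "f \<in> Arr C" "A \<in> Obj C" "B \<in> Obj C" "D \<in> Obj C"
  shows "Cod C f = (A \<odot> B) \<odot> D \<Longrightarrow> br A B D \<bullet> bl A B D \<bullet> f = f"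
    "Cod C f = A \<odot> B \<odot> D \<Longrightarrow> bl A B D \<bullet> br A B D \<bullet> f = f"
  using assms by (simp_all add: Comp_reassoc[OF b_right_left] Comp_reassoc[OF b_left_right])

lemma sigma_nat: "f \<in> Arr C \<Longrightarrow> Dom C f = A \<Longrightarrow> Cod C f = B \<Longrightarrow> \<sigma> B \<bullet> (\<one> \<I> \<otimes> f) = f \<bullet> \<sigma> A"
  by (simp add: sigma_natural[of f A B] hom_def)

lemma delta_nat: "f \<in> Arr C \<Longrightarrow> Dom C f = A \<Longrightarrow> Cod C f = B \<Longrightarrow> \<delta> B \<bullet> (f \<otimes> \<one> \<I>) = f \<bullet> \<delta> A"
  by (simp add: delta_natural[of f A B] hom_def)

lemma sigma_inv_nat:
  assumes "f \<in> Arr C" "Dom C f = A" "Cod C f = B"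
  shows "\<sigma>\<^sup>i B \<bullet> f = (\<one> \<I> \<otimes> f) \<bullet> \<sigma>\<^sup>i A"
proof -
  have [simp]: "A \<in> Obj C" "B \<in> Obj C" using assms by auto
  have "\<sigma>\<^sup>i B \<bullet> f = \<sigma>\<^sup>i B \<bullet> f \<bullet> \<sigma> A \<bullet> \<sigma>\<^sup>i A" using assms by simp
  also have "\<dots> = \<sigma>\<^sup>i B \<bullet> \<sigma> B \<bullet> (\<one> \<I> \<otimes> f) \<bullet> \<sigma>\<^sup>i A"
    using assms by (simp add: Comp_reassoc[OF sigma_nat] del: unit_inverse_Comp sigma_sigma_inv)
  also have "\<dots> = (\<one> \<I> \<otimes> f) \<bullet> \<sigma>\<^sup>i A" using assms by simp
  finally show ?thesis .
qed

lemma delta_inv_nat: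
  assumes "f \<in> Arr C" "Dom C f = A" "Cod C f = B"
  shows "\<delta>\<^sup>i B \<bullet> f = (f \<otimes> \<one> \<I>) \<bullet> \<delta>\<^sup>i A"
proof -
  have [simp]: "A \<in> Obj C" "B \<in> Obj C" using assms by auto
  have "\<delta>\<^sup>i B \<bullet> f = \<delta>\<^sup>i B \<bullet> f \<bullet> \<delta> A \<bullet> \<delta>\<^sup>i A" using assms by simp
  also have "\<dots> = \<delta>\<^sup>i B \<bullet> \<delta> B \<bullet> (f \<otimes> \<one> \<I>) \<bullet> \<delta>\<^sup>i A"
    using assms by (simp add: Comp_reassoc[OF delta_nat] del: unit_inverse_Comp delta_delta_inv)
  also have "\<dots> = (f \<otimes> \<one> \<I>) \<bullet> \<delta>\<^sup>i A" using assms by simp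
  finally show ?thesis .
qed

lemma br_nat:
  assumes "f \<in> Arr C" "g \<in> Arr C" "h \<in> Arr C" "Dom C f = A" "Dom C g = B" "Dom C h = D"
  shows "((f \<otimes> g) \<otimes> h) \<bullet> br A B D = br (Cod C f) (Cod C g) (Cod C h) \<bullet> (f \<otimes> g \<otimes> h)"
  using b_right_natural[of f A "Cod C f" g B "Cod C g" h D "Cod C h"] assms by (simp add: hom_def)

lemma bl_nat:
  assumes "f \<in> Arr C" "g \<in> Arr C" "h \<in> Arr C" "Cod C f = A" "Cod C g = B" "Cod C h = D"
  shows "bl A B D \<bullet> ((f \<otimes> g) \<otimes> h) = (f \<otimes> g \<otimes> h) \<bullet> bl (Dom C f) (Dom C g) (Dom C h)"
proof -
  let ?d = "br (Dom C f) (Dom C g) (Dom C h)" and ?d' = "bl (Dom C f) (Dom C g) (Dom C h)"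
  have [simp]: "A \<in> Obj C" "B \<in> Obj C" "D \<in> Obj C" using assms by auto
  have "bl A B D \<bullet> ((f \<otimes> g) \<otimes> h) = bl A B D \<bullet> ((f \<otimes> g) \<otimes> h) \<bullet> ?d \<bullet> ?d'" using assms by simp
  also have "\<dots> = bl A B D \<bullet> br A B D \<bullet> (f \<otimes> g \<otimes> h) \<bullet> ?d'"
    using assms Comp_reassoc[OF br_nat[of f g h "Dom C f" "Dom C g" "Dom C h"]]
    by (simp del: b_inverse_Comp b_right_left)
  finally show ?thesis using assms by simp
qed

text \<open>Mac Lane's two further unit axioms, which Kelly showed to be redundant.\<close>

lemma sigma_mult:
  assumes [simp]: "A \<in> Obj C" "B \<in> Obj C"
  shows "(\<sigma> A \<otimes> \<one> B) \<bullet> br \<I> A B = \<sigma> (A \<odot> B)" (is "?l = ?r")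
proof -
  \<comment> \<open>Multiplying by \<I> on the left makes room for the pentagon at
    \<open>\<I>, \<I>, A, B\<close>, whose edges the triangle converts into unit arrows.\<close>
  have "br \<I> A B \<bullet> (\<one> \<I> \<otimes> ?l) = br \<I> A B \<bullet> (\<one> \<I> \<otimes> \<sigma> A \<otimes> \<one> B) \<bullet> (\<one> \<I> \<otimes> br \<I> A B)"
    by simp
  also have "\<dots> = ((\<one> \<I> \<otimes> \<sigma> A) \<otimes> \<one> B) \<bullet> br \<I> (\<I> \<odot> A) B \<bullet> (\<one> \<I> \<otimes> br \<I> A B)"
    using Comp_reassoc[OF br_nat[of "\<one> \<I>" "\<sigma> A" "\<one> B" \<I> "\<I> \<odot> A" B]] by simp
  also have "\<dots> = ((\<delta> \<I> \<otimes> \<one> A) \<otimes> \<one> B) \<bullet> (br \<I> \<I> A \<otimes> \<one> B) \<bullet> br \<I> (\<I> \<odot> A) B \<bullet> (\<one> \<I> \<otimes> br \<I> A B)"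
    by (simp add: triangle)
  also have "\<dots> = ((\<delta> \<I> \<otimes> \<one> A) \<otimes> \<one> B) \<bullet> br (\<I> \<odot> \<I>) A B \<bullet> br \<I> \<I> (A \<odot> B)"
    by (simp only: pentagon[symmetric] assms unit_obj_closed)
  also have "\<dots> = br \<I> A B \<bullet> (\<delta> \<I> \<otimes> \<one> A \<otimes> \<one> B) \<bullet> br \<I> \<I> (A \<odot> B)"
    using Comp_reassoc[OF br_nat[of "\<delta> \<I>" "\<one> A" "\<one> B" "\<I> \<odot> \<I>" A B]] by simp
  also have "\<dots> = br \<I> A B \<bullet> (\<one> \<I> \<otimes> ?r)"
    by (simp add: triangle)
  finally have "\<one> \<I> \<otimes> ?l = \<one> \<I> \<otimes> ?r"
    by (rule mono_cancel[where u' = "bl \<I> A B"]) simp_all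
  \<comment> \<open>The factor \<open>\<one> \<I>\<close> is removed by naturality of \<sigma>,
    which is invertible.\<close>
  then have "\<sigma> (A \<odot> B) \<bullet> (\<one> \<I> \<otimes> ?l) = \<sigma> (A \<odot> B) \<bullet> (\<one> \<I> \<otimes> ?r)" by simp
  moreover have "\<sigma> (A \<odot> B) \<bullet> (\<one> \<I> \<otimes> ?l) = ?l \<bullet> \<sigma> (\<I> \<odot> A \<odot> B)"
    by (rule sigma_nat) simp_all
  moreover have "\<sigma> (A \<odot> B) \<bullet> (\<one> \<I> \<otimes> ?r) = ?r \<bullet> \<sigma> (\<I> \<odot> A \<odot> B)"
    by (rule sigma_nat) simp_all
  ultimately have "?l \<bullet> \<sigma> (\<I> \<odot> A \<odot> B) = ?r \<bullet> \<sigma> (\<I> \<odot> A \<odot> B)" by metis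
  then show ?thesis
    by (rule epi_cancel[OF _ sigma_sigma_inv]) simp_all
qed

lemma delta_mult:
  assumes [simp]: "A \<in> Obj C" "B \<in> Obj C"
  shows "\<delta> (A \<odot> B) \<bullet> br A B \<I> = \<one> A \<otimes> \<delta> B" (is "?l = ?r")
proof -
  \<comment> \<open>The mirror image of the preceding argument: \<I> is multiplied on the right, and
    \<open>?u\<close> consists of two edges of the pentagon at
    \<open>A, B, \<I>, \<I>\<close>.\<close>
  let ?u = "br A (B \<odot> \<I>) \<I> \<bullet> (\<one> A \<otimes> br B \<I> \<I>)"
  have "(?l \<otimes> \<one> \<I>) \<bullet> ?u = (\<delta> (A \<odot> B) \<otimes> \<one> \<I>) \<bullet> (br A B \<I> \<otimes> \<one> \<I>) \<bullet> ?u"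
    by simp
  also have "\<dots> = (\<delta> (A \<odot> B) \<otimes> \<one> \<I>) \<bullet> br (A \<odot> B) \<I> \<I> \<bullet> br A B (\<I> \<odot> \<I>)"
    by (simp only: pentagon[symmetric] assms unit_obj_closed)
  also have "\<dots> = ((\<one> A \<otimes> \<one> B) \<otimes> \<sigma> \<I>) \<bullet> br A B (\<I> \<odot> \<I>)"
    by (simp add: Comp_reassoc[OF triangle])
  also have "\<dots> = br A B \<I> \<bullet> (\<one> A \<otimes> \<one> B \<otimes> \<sigma> \<I>)"
    by (subst br_nat) simp_all
  also have "\<dots> = br A B \<I> \<bullet> (\<one> A \<otimes> \<delta> B \<otimes> \<one> \<I>) \<bullet> (\<one> A \<otimes> br B \<I> \<I>)"
    by (simp add: triangle)
  also have "\<dots> = (?r \<otimes> \<one> \<I>) \<bullet> ?u"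
    using Comp_reassoc[OF br_nat[of "\<one> A" "\<delta> B" "\<one> \<I>" A "B \<odot> \<I>" \<I>]] by simp
  finally have "?l \<otimes> \<one> \<I> = ?r \<otimes> \<one> \<I>"
    by (rule epi_cancel[where u' = "(\<one> A \<otimes> bl B \<I> \<I>) \<bullet> bl A (B \<odot> \<I>) \<I>"]) simp_all
  then have "\<delta> (A \<odot> B) \<bullet> (?l \<otimes> \<one> \<I>) = \<delta> (A \<odot> B) \<bullet> (?r \<otimes> \<one> \<I>)" by simp
  moreover have "\<delta> (A \<odot> B) \<bullet> (?l \<otimes> \<one> \<I>) = ?l \<bullet> \<delta> (A \<odot> B \<odot> \<I>)"
    by (rule delta_nat) simp_all
  moreover have "\<delta> (A \<odot> B) \<bullet> (?r \<otimes> \<one> \<I>) = ?r \<bullet> \<delta> (A \<odot> B \<odot> \<I>)"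
    by (rule delta_nat) simp_all
  ultimately have "?l \<bullet> \<delta> (A \<odot> B \<odot> \<I>) = ?r \<bullet> \<delta> (A \<odot> B \<odot> \<I>)" by metis
  then show ?thesis
    by (rule epi_cancel[OF _ delta_delta_inv]) simp_all
qed

lemma pentagon_right:
  assumes [simp]: "A \<in> Obj C" "B \<in> Obj C" "D \<in> Obj C" "E \<in> Obj C"
  shows "(bl A B D \<otimes> \<one> E) \<bullet> br (A \<odot> B) D E = br A (B \<odot> D) E \<bullet> (\<one> A \<otimes> br B D E) \<bullet> bl A B (D \<odot> E)"
    (is "?l = ?r")
proof -
  have "?l = (bl A B D \<otimes> \<one> E) \<bullet> (br (A \<odot> B) D E \<bullet> br A B (D \<odot> E)) \<bullet> bl A B (D \<odot> E)" by simp
  also have "\<dots> = (bl A B D \<otimes> \<one> E) \<bullet> ((br A B D \<otimes> \<one> E) \<bullet> br A (B \<odot> D) E \<bullet> (\<one> A \<otimes> br B D E)) \<bullet> bl A B (D \<odot> E)"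
    by (simp only: pentagon assms)
  also have "\<dots> = ?r" by simp
  finally show ?thesis .
qed

lemma pentagon_left:
  assumes [simp]: "A \<in> Obj C" "B \<in> Obj C" "D \<in> Obj C" "E \<in> Obj C"
  shows "bl A (B \<odot> D) E = (\<one> A \<otimes> br B D E) \<bullet> bl A B (D \<odot> E) \<bullet> bl (A \<odot> B) D E \<bullet> (br A B D \<otimes> \<one> E)"
    (is "?l = ?r")
proof -
  have "?r = bl A (B \<odot> D) E \<bullet> (br A (B \<odot> D) E \<bullet> (\<one> A \<otimes> br B D E) \<bullet> bl A B (D \<odot> E)) \<bullet> bl (A \<odot> B) D E \<bullet> (br A B D \<otimes> \<one> E)"
    by simp
  also have "\<dots> = bl A (B \<odot> D) E \<bullet> ((bl A B D \<otimes> \<one> E) \<bullet> br (A \<odot> B) D E) \<bullet> bl (A \<odot> B) D E \<bullet> (br A B D \<otimes> \<one> E)"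
    by (simp only: pentagon_right assms)
  also have "\<dots> = ?l" by simp
  finally show ?thesis ..
qed

lemma delta_inv_unit: "\<delta>\<^sup>i \<I> = \<sigma>\<^sup>i \<I>"
proof -
  have "\<sigma> \<I> \<bullet> \<delta>\<^sup>i \<I> = \<delta> \<I> \<bullet> \<delta>\<^sup>i \<I>" by (simp only: sigma_unit)
  also have "\<dots> = \<sigma> \<I> \<bullet> \<sigma>\<^sup>i \<I>" by simp
  finally have "\<sigma> \<I> \<bullet> \<delta>\<^sup>i \<I> = \<sigma> \<I> \<bullet> \<sigma>\<^sup>i \<I>" .
  then show ?thesis by (rule mono_cancel[OF _ sigma_inv_sigma]) simp_all
qed

text \<open>Together with \<open>br_sigma_inv\<close> and \<open>br_triangle_inv\<close> this covers
  a unit in the last, first and middle place; these are the cases of \<open>var_split_assoc\<close>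
  in which one of three factors is absent.\<close>

lemma br_delta_inv:
  assumes [simp]: "A \<in> Obj C" "B \<in> Obj C"
  shows "br A B \<I> \<bullet> (\<one> A \<otimes> \<delta>\<^sup>i B) = \<delta>\<^sup>i (A \<odot> B)"
proof -
  have "\<delta> (A \<odot> B) \<bullet> br A B \<I> \<bullet> (\<one> A \<otimes> \<delta>\<^sup>i B) = \<delta> (A \<odot> B) \<bullet> \<delta>\<^sup>i (A \<odot> B)"
    by (simp add: Comp_reassoc[OF delta_mult])
  then show ?thesis by (rule mono_cancel[OF _ delta_inv_delta]) simp_all
qed

lemma br_sigma_inv:
  assumes [simp]: "A \<in> Obj C" "B \<in> Obj C"
  shows "br \<I> A B \<bullet> \<sigma>\<^sup>i (A \<odot> B) = \<sigma>\<^sup>i A \<otimes> \<one> B"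
proof -
  have "(\<sigma> A \<otimes> \<one> B) \<bullet> br \<I> A B \<bullet> \<sigma>\<^sup>i (A \<odot> B) = (\<sigma> A \<otimes> \<one> B) \<bullet> (\<sigma>\<^sup>i A \<otimes> \<one> B)"
    by (simp add: Comp_reassoc[OF sigma_mult])
  then show ?thesis by (rule mono_cancel[where u' = "\<sigma>\<^sup>i A \<otimes> \<one> B"]) simp_all
qed

lemma br_triangle_inv:
  assumes [simp]: "A \<in> Obj C" "B \<in> Obj C"
  shows "br A \<I> B \<bullet> (\<one> A \<otimes> \<sigma>\<^sup>i B) = \<delta>\<^sup>i A \<otimes> \<one> B"
proof -
  have "(\<delta> A \<otimes> \<one> B) \<bullet> br A \<I> B \<bullet> (\<one> A \<otimes> \<sigma>\<^sup>i B) = (\<delta> A \<otimes> \<one> B) \<bullet> (\<delta>\<^sup>i A \<otimes> \<one> B)"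
    by (simp add: Comp_reassoc[OF triangle])
  then show ?thesis by (rule mono_cancel[where u' = "\<delta>\<^sup>i A \<otimes> \<one> B"]) simp_all
qed

lemma has_section_primitive:
  assumes "A \<in> Obj C"
  shows "has_section (\<sigma> A)" "has_section (\<sigma>\<^sup>i A)" "has_section (\<delta> A)" "has_section (\<delta>\<^sup>i A)"
  using assms by (auto intro: has_sectionI[of _ "\<sigma>\<^sup>i A"] has_sectionI[of _ "\<sigma> A"]
      has_sectionI[of _ "\<delta>\<^sup>i A"] has_sectionI[of _ "\<delta> A"])

end

section \<open>Symmetric monoidal categories\<close>

context symmetric_monoidal_category
begin

lemma sym_arr [simp]:
  assumes "A \<in> Obj C" "B \<in> Obj C"
  shows "\<c> A B \<in> Arr C" "Dom C (\<c> A B) = A \<odot> B" "Cod C (\<c> A B) = B \<odot> A"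
  using sym_hom[OF assms] by (auto simp: hom_def)

declare sym_sym [simp]

lemma sym_sym_Comp [simp]:
  assumes "A \<in> Obj C" "B \<in> Obj C" "f \<in> Arr C" "Cod C f = A \<odot> B"
  shows "\<c> B A \<bullet> \<c> A B \<bullet> f = f"
  using assms by (simp add: Comp_reassoc[OF sym_sym])

lemma sym_nat:
  assumes "f \<in> Arr C" "g \<in> Arr C"
  shows "\<c> (Cod C f) (Cod C g) \<bullet> (f \<otimes> g) = (g \<otimes> f) \<bullet> \<c> (Dom C f) (Dom C g)"
  using sym_natural[of f "Dom C f" "Cod C f" g "Dom C g" "Cod C g"] assms by (simp add: hom_def)

lemma delta_sym: "A \<in> Obj C \<Longrightarrow> \<delta> A \<bullet> \<c> \<I> A = \<sigma> A"
  by (simp add: sigma_sym[symmetric])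

text \<open>
  Diagrams are compared after rebracketing all products to the right, where a symmetry is an exchange
  of two leading factors and the hexagon says how an exchange passes a composite factor.
\<close>

definition exch :: "'o \<Rightarrow> 'o \<Rightarrow> 'o \<Rightarrow> 'a" where
  "exch A B X = bl B A X \<bullet> (\<c> A B \<otimes> \<one> X) \<bullet> br A B X"

lemma exch_arr [simp]:
  assumes "A \<in> Obj C" "B \<in> Obj C" "X \<in> Obj C"
  shows "exch A B X \<in> Arr C" "Dom C (exch A B X) = A \<odot> B \<odot> X" "Cod C (exch A B X) = B \<odot> A \<odot> X"
  using assms by (simp_all add: exch_def)

lemma exch_exch [simp]:
  assumes [simp]: "A \<in> Obj C" "B \<in> Obj C" "X \<in> Obj C"
  shows "exch B A X \<bullet> exch A B X = \<one> (A \<odot> B \<odot> X)"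
  by (simp add: exch_def)

lemma exch_exch_Comp [simp]:
  assumes "A \<in> Obj C" "B \<in> Obj C" "X \<in> Obj C" "f \<in> Arr C" "Cod C f = A \<odot> B \<odot> X"
  shows "exch B A X \<bullet> exch A B X \<bullet> f = f"
  using assms by (simp add: Comp_reassoc[OF exch_exch])

lemma exch_nat:
  assumes [simp]: "f \<in> Arr C" "g \<in> Arr C" "h \<in> Arr C"
  shows "exch (Cod C f) (Cod C g) (Cod C h) \<bullet> (f \<otimes> g \<otimes> h) =
    (g \<otimes> f \<otimes> h) \<bullet> exch (Dom C f) (Dom C g) (Dom C h)"
proof -
  have "exch (Cod C f) (Cod C g) (Cod C h) \<bullet> (f \<otimes> g \<otimes> h) =
      bl (Cod C g) (Cod C f) (Cod C h) \<bullet> (\<c> (Cod C f) (Cod C g) \<otimes> \<one> (Cod C h)) \<bullet>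
      br (Cod C f) (Cod C g) (Cod C h) \<bullet> (f \<otimes> g \<otimes> h)"
    by (simp add: exch_def)
  also have "br (Cod C f) (Cod C g) (Cod C h) \<bullet> (f \<otimes> g \<otimes> h) =
      ((f \<otimes> g) \<otimes> h) \<bullet> br (Dom C f) (Dom C g) (Dom C h)"
    by (simp add: br_nat)
  also have "bl (Cod C g) (Cod C f) (Cod C h) \<bullet> (\<c> (Cod C f) (Cod C g) \<otimes> \<one> (Cod C h)) \<bullet> \<dots> =
      bl (Cod C g) (Cod C f) (Cod C h) \<bullet> ((g \<otimes> f) \<otimes> h) \<bullet>
      (\<c> (Dom C f) (Dom C g) \<otimes> \<one> (Dom C h)) \<bullet> br (Dom C f) (Dom C g) (Dom C h)"
    by (simp add: sym_nat)
  also have "\<dots> = (g \<otimes> f \<otimes> h) \<bullet> bl (Dom C g) (Dom C f) (Dom C h) \<bullet>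
      (\<c> (Dom C f) (Dom C g) \<otimes> \<one> (Dom C h)) \<bullet> br (Dom C f) (Dom C g) (Dom C h)"
    using Comp_reassoc[OF bl_nat[of g f h "Cod C g" "Cod C f" "Cod C h", symmetric]] by simp
  finally show ?thesis by (simp add: exch_def)
qed

text \<open>The hexagon with a tail \<open>X\<close>. Pentagons on both sides collect the symmetry
  and its neighbours under \<open>_ \<otimes> \<one> X\<close>, the hexagon is applied there, and
  one more pentagon restores the right bracketing.\<close>

lemma exch_mult_left:
  assumes [simp]: "A \<in> Obj C" "B \<in> Obj C" "D \<in> Obj C" "X \<in> Obj C"
  shows "exch (A \<odot> B) D X \<bullet> br A B (D \<odot> X) =
    (\<one> D \<otimes> br A B X) \<bullet> exch A D (B \<odot> X) \<bullet> (\<one> A \<otimes> exch B D X)"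
proof -
  let ?p = "(\<one> D \<otimes> br A B X) \<bullet> bl D A (B \<odot> X)"
  have "exch (A \<odot> B) D X \<bullet> br A B (D \<odot> X) =
      bl D (A \<odot> B) X \<bullet> (\<c> (A \<odot> B) D \<otimes> \<one> X) \<bullet> (br (A \<odot> B) D X \<bullet> br A B (D \<odot> X))"
    by (simp add: exch_def)
  also have "\<dots> = ((\<one> D \<otimes> br A B X) \<bullet> bl D A (B \<odot> X) \<bullet> bl (D \<odot> A) B X \<bullet> (br D A B \<otimes> \<one> X)) \<bullet>
      (\<c> (A \<odot> B) D \<otimes> \<one> X) \<bullet> ((br A B D \<otimes> \<one> X) \<bullet> br A (B \<odot> D) X \<bullet> (\<one> A \<otimes> br B D X))"
    by (simp only: pentagon pentagon_left assms)
  also have "\<dots> = ?p \<bullet> bl (D \<odot> A) B X \<bullet> ((br D A B \<bullet> \<c> (A \<odot> B) D \<bullet> br A B D) \<otimes> \<one> X) \<bullet>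
      br A (B \<odot> D) X \<bullet> (\<one> A \<otimes> br B D X)"
    by simp
  also have "\<dots> = ?p \<bullet> bl (D \<odot> A) B X \<bullet> (((\<c> A D \<otimes> \<one> B) \<bullet> br A D B \<bullet> (\<one> A \<otimes> \<c> B D)) \<otimes> \<one> X) \<bullet>
      br A (B \<odot> D) X \<bullet> (\<one> A \<otimes> br B D X)"
    by (simp only: hexagon assms)
  also have "\<dots> = ?p \<bullet> (bl (D \<odot> A) B X \<bullet> ((\<c> A D \<otimes> \<one> B) \<otimes> \<one> X)) \<bullet> (br A D B \<otimes> \<one> X) \<bullet>
      (((\<one> A \<otimes> \<c> B D) \<otimes> \<one> X) \<bullet> br A (B \<odot> D) X) \<bullet> (\<one> A \<otimes> br B D X)"
    by simp
  also have "((\<one> A \<otimes> \<c> B D) \<otimes> \<one> X) \<bullet> br A (B \<odot> D) X = br A (D \<odot> B) X \<bullet> (\<one> A \<otimes> \<c> B D \<otimes> \<one> X)"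
    by (simp add: br_nat)
  also have "bl (D \<odot> A) B X \<bullet> ((\<c> A D \<otimes> \<one> B) \<otimes> \<one> X) = (\<c> A D \<otimes> \<one> (B \<odot> X)) \<bullet> bl (A \<odot> D) B X"
    by (simp add: bl_nat)
  also have "?p \<bullet> ((\<c> A D \<otimes> \<one> (B \<odot> X)) \<bullet> bl (A \<odot> D) B X) \<bullet> (br A D B \<otimes> \<one> X) \<bullet>
      (br A (D \<odot> B) X \<bullet> (\<one> A \<otimes> \<c> B D \<otimes> \<one> X)) \<bullet> (\<one> A \<otimes> br B D X) =
      ?p \<bullet> (\<c> A D \<otimes> \<one> (B \<odot> X)) \<bullet> bl (A \<odot> D) B X \<bullet>
      ((br A D B \<otimes> \<one> X) \<bullet> br A (D \<odot> B) X \<bullet> (\<one> A \<otimes> br D B X)) \<bullet> (\<one> A \<otimes> exch B D X)"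
    by (simp add: exch_def)
  also have "\<dots> = ?p \<bullet> (\<c> A D \<otimes> \<one> (B \<odot> X)) \<bullet> bl (A \<odot> D) B X \<bullet>
      (br (A \<odot> D) B X \<bullet> br A D (B \<odot> X)) \<bullet> (\<one> A \<otimes> exch B D X)"
    by (simp only: pentagon assms)
  finally show ?thesis by (simp add: exch_def)
qed

text \<open>Obtained from \<open>exch_mult_left\<close> by inverting: \<open>exch A B X\<close> and
  \<open>exch B A X\<close> are mutually inverse.\<close>

lemma exch_mult_right:
  assumes [simp]: "A \<in> Obj C" "B \<in> Obj C" "D \<in> Obj C" "X \<in> Obj C"
  shows "exch A (B \<odot> D) X \<bullet> (\<one> A \<otimes> br B D X) =
    br B D (A \<odot> X) \<bullet> (\<one> B \<otimes> exch A D X) \<bullet> exch A B (D \<odot> X)" (is "?l = ?r")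
proof -
  have "?l = exch A (B \<odot> D) X \<bullet> ((\<one> A \<otimes> br B D X) \<bullet> exch B A (D \<odot> X) \<bullet> (\<one> B \<otimes> exch D A X)) \<bullet>
      (\<one> B \<otimes> exch A D X) \<bullet> exch A B (D \<odot> X)"
    by simp
  also have "\<dots> = exch A (B \<odot> D) X \<bullet> (exch (B \<odot> D) A X \<bullet> br B D (A \<odot> X)) \<bullet>
      (\<one> B \<otimes> exch A D X) \<bullet> exch A B (D \<odot> X)"
    by (simp only: exch_mult_left assms)
  also have "\<dots> = ?r" by simp
  finally show ?thesis .
qed

text \<open>An exchange touches the two leading factors alone, so a further factor \<open>E\<close>
  on the right can be absorbed into its tail.\<close>

lemma exch_br:
  assumes [simp]: "A \<in> Obj C" "B \<in> Obj C" "D \<in> Obj C" "E \<in> Obj C"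
  shows "(exch A B D \<otimes> \<one> E) \<bullet> br A (B \<odot> D) E \<bullet> (\<one> A \<otimes> br B D E) =
    br B (A \<odot> D) E \<bullet> (\<one> B \<otimes> br A D E) \<bullet> exch A B (D \<odot> E)" (is "?l = ?r")
proof -
  have "?l = (bl B A D \<otimes> \<one> E) \<bullet> ((\<c> A B \<otimes> \<one> D) \<otimes> \<one> E) \<bullet>
      ((br A B D \<otimes> \<one> E) \<bullet> br A (B \<odot> D) E \<bullet> (\<one> A \<otimes> br B D E))"
    by (simp add: exch_def)
  also have "\<dots> = (bl B A D \<otimes> \<one> E) \<bullet> ((\<c> A B \<otimes> \<one> D) \<otimes> \<one> E) \<bullet> (br (A \<odot> B) D E \<bullet> br A B (D \<odot> E))"
    by (simp only: pentagon assms)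
  also have "\<dots> = (bl B A D \<otimes> \<one> E) \<bullet> (((\<c> A B \<otimes> \<one> D) \<otimes> \<one> E) \<bullet> br (A \<odot> B) D E) \<bullet> br A B (D \<odot> E)"
    by simp
  also have "((\<c> A B \<otimes> \<one> D) \<otimes> \<one> E) \<bullet> br (A \<odot> B) D E = br (B \<odot> A) D E \<bullet> (\<c> A B \<otimes> \<one> D \<otimes> \<one> E)"
    by (simp only: br_nat sym_arr Id_arr assms mult_obj_closed)
  also have "(bl B A D \<otimes> \<one> E) \<bullet> (br (B \<odot> A) D E \<bullet> (\<c> A B \<otimes> \<one> D \<otimes> \<one> E)) \<bullet> br A B (D \<odot> E) =
      ((bl B A D \<otimes> \<one> E) \<bullet> br (B \<odot> A) D E) \<bullet> (\<c> A B \<otimes> \<one> D \<otimes> \<one> E) \<bullet> br A B (D \<odot> E)"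
    by simp
  also have "\<dots> = (br B (A \<odot> D) E \<bullet> (\<one> B \<otimes> br A D E) \<bullet> bl B A (D \<odot> E)) \<bullet> (\<c> A B \<otimes> \<one> D \<otimes> \<one> E) \<bullet> br A B (D \<odot> E)"
    by (simp only: pentagon_right assms)
  also have "\<dots> = ?r" by (simp add: exch_def)
  finally show ?thesis .
qed

text \<open>At the end of a right-bracketed product a symmetry has no tail and is not an
  \<open>exch\<close>. This and \<open>sym_mult_right\<close> are the hexagon in that
  position.\<close>

lemma sym_mult_left:
  assumes [simp]: "A \<in> Obj C" "B \<in> Obj C" "D \<in> Obj C"
  shows "\<c> (A \<odot> B) D \<bullet> br A B D = exch A D B \<bullet> (\<one> A \<otimes> \<c> B D)"
proof -
  have "\<c> (A \<odot> B) D \<bullet> br A B D = bl D A B \<bullet> (br D A B \<bullet> \<c> (A \<odot> B) D \<bullet> br A B D)" by simp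
  also have "\<dots> = bl D A B \<bullet> ((\<c> A D \<otimes> \<one> B) \<bullet> br A D B \<bullet> (\<one> A \<otimes> \<c> B D))"
    by (simp only: hexagon assms)
  finally show ?thesis by (simp add: exch_def)
qed

lemma sym_mult_right:
  assumes [simp]: "A \<in> Obj C" "B \<in> Obj C" "D \<in> Obj C"
  shows "\<c> A (B \<odot> D) \<bullet> exch B A D = br B D A \<bullet> (\<one> B \<otimes> \<c> A D)"
proof -
  have "\<c> A (B \<odot> D) \<bullet> exch B A D = \<c> A (B \<odot> D) \<bullet> (exch B A D \<bullet> (\<one> B \<otimes> \<c> D A)) \<bullet> (\<one> B \<otimes> \<c> A D)"
    by simp
  also have "\<dots> = \<c> A (B \<odot> D) \<bullet> (\<c> (B \<odot> D) A \<bullet> br B D A) \<bullet> (\<one> B \<otimes> \<c> A D)"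
    by (simp only: sym_mult_left assms)
  finally show ?thesis by simp
qed

lemma sigma_exch:
  assumes [simp]: "A \<in> Obj C" "B \<in> Obj C"
  shows "\<sigma> (A \<odot> B) \<bullet> exch A \<I> B = \<one> A \<otimes> \<sigma> B"
proof -
  have "\<sigma> (A \<odot> B) \<bullet> exch A \<I> B = ((\<sigma> A \<otimes> \<one> B) \<bullet> br \<I> A B) \<bullet> exch A \<I> B"
    by (simp only: sigma_mult assms)
  also have "\<dots> = ((\<sigma> A \<bullet> \<c> A \<I>) \<otimes> \<one> B) \<bullet> br A \<I> B"
    by (simp add: exch_def)
  finally show ?thesis by (simp add: sigma_sym triangle)
qed

section \<open>The middle interchange \<open>cm\<close>\<close>

abbreviation (input) "cm \<equiv> middle_sym C"

lemma middle_sym_exch: "cm A B D E = br A D (B \<odot> E) \<bullet> (\<one> A \<otimes> exch B D E) \<bullet> bl A B (D \<odot> E)"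
  by (simp add: middle_sym_def exch_def)

lemma middle_sym_arr [simp]:
  assumes "A \<in> Obj C" "B \<in> Obj C" "D \<in> Obj C" "E \<in> Obj C"
  shows "cm A B D E \<in> Arr C" "Dom C (cm A B D E) = (A \<odot> B) \<odot> D \<odot> E"
    "Cod C (cm A B D E) = (A \<odot> D) \<odot> B \<odot> E"
  using assms by (simp_all add: middle_sym_exch)

text \<open>Once its source is bracketed to the right, \<open>cm\<close> is one exchange followed by
  a rebracketing. All diagrams with \<open>cm\<close> below are computed through this form.\<close>

lemma middle_sym_br:
  assumes [simp]: "A \<in> Obj C" "B \<in> Obj C" "D \<in> Obj C" "E \<in> Obj C"
  shows "cm A B D E \<bullet> br A B (D \<odot> E) = br A D (B \<odot> E) \<bullet> (\<one> A \<otimes> exch B D E)"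
  by (simp add: middle_sym_exch)

lemma middle_sym_inverse:
  assumes [simp]: "A \<in> Obj C" "B \<in> Obj C" "D \<in> Obj C" "E \<in> Obj C"
  shows "cm A D B E \<bullet> cm A B D E = \<one> ((A \<odot> B) \<odot> D \<odot> E)"
  by (simp add: middle_sym_exch)

lemma middle_sym_nat:
  assumes [simp]: "f \<in> Arr C" "g \<in> Arr C" "h \<in> Arr C" "k \<in> Arr C"
  shows "cm (Cod C f) (Cod C g) (Cod C h) (Cod C k) \<bullet> ((f \<otimes> g) \<otimes> h \<otimes> k) =
    ((f \<otimes> h) \<otimes> g \<otimes> k) \<bullet> cm (Dom C f) (Dom C g) (Dom C h) (Dom C k)"
proof -
  let ?l = "bl (Dom C f) (Dom C g) (Dom C h \<odot> Dom C k)"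
  have "cm (Cod C f) (Cod C g) (Cod C h) (Cod C k) \<bullet> ((f \<otimes> g) \<otimes> h \<otimes> k) =
      br (Cod C f) (Cod C h) (Cod C g \<odot> Cod C k) \<bullet> (\<one> (Cod C f) \<otimes> exch (Cod C g) (Cod C h) (Cod C k)) \<bullet>
      (f \<otimes> g \<otimes> h \<otimes> k) \<bullet> ?l"
    using bl_nat[of f g "h \<otimes> k", symmetric] by (simp add: middle_sym_exch)
  also have "\<dots> = br (Cod C f) (Cod C h) (Cod C g \<odot> Cod C k) \<bullet> (f \<otimes> h \<otimes> g \<otimes> k) \<bullet>
      (\<one> (Dom C f) \<otimes> exch (Dom C g) (Dom C h) (Dom C k)) \<bullet> ?l"
    by (simp add: exch_nat)
  also have "\<dots> = ((f \<otimes> h) \<otimes> g \<otimes> k) \<bullet> br (Dom C f) (Dom C h) (Dom C g \<odot> Dom C k) \<bullet>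
      (\<one> (Dom C f) \<otimes> exch (Dom C g) (Dom C h) (Dom C k)) \<bullet> ?l"
    using Comp_reassoc[OF br_nat[of f h "g \<otimes> k" "Dom C f" "Dom C h" "Dom C g \<odot> Dom C k"]] by simp
  finally show ?thesis by (simp add: middle_sym_exch)
qed

text \<open>Brings \<open>cm\<close> with an idle factor \<open>Y\<close> into right-bracketed form,
  where it is again a single exchange, now with the longer tail \<open>B' \<odot> Y\<close>.\<close>

lemma middle_sym_mult_Id:
  assumes [simp]: "A \<in> Obj C" "A' \<in> Obj C" "B \<in> Obj C" "B' \<in> Obj C" "Y \<in> Obj C"
  shows "(cm A B A' B' \<otimes> \<one> Y) \<bullet> br (A \<odot> B) (A' \<odot> B') Y \<bullet> (\<one> (A \<odot> B) \<otimes> br A' B' Y) \<bullet> br A B (A' \<odot> B' \<odot> Y) =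
    br (A \<odot> A') (B \<odot> B') Y \<bullet> (\<one> (A \<odot> A') \<otimes> br B B' Y) \<bullet> br A A' (B \<odot> B' \<odot> Y) \<bullet> (\<one> A \<otimes> exch B A' (B' \<odot> Y))"
    (is "?l = ?r")
proof -
  let ?e = "(br A A' (B \<odot> B') \<otimes> \<one> Y) \<bullet> ((\<one> A \<otimes> exch B A' B') \<otimes> \<one> Y)"
  have "?l = ?e \<bullet> (bl A B (A' \<odot> B') \<otimes> \<one> Y) \<bullet> br (A \<odot> B) (A' \<odot> B') Y \<bullet>
      (((\<one> A \<otimes> \<one> B) \<otimes> br A' B' Y) \<bullet> br A B (A' \<odot> B' \<odot> Y))"
    by (simp add: middle_sym_exch)
  also have "((\<one> A \<otimes> \<one> B) \<otimes> br A' B' Y) \<bullet> br A B (A' \<odot> B' \<odot> Y) =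
      br A B ((A' \<odot> B') \<odot> Y) \<bullet> (\<one> A \<otimes> \<one> B \<otimes> br A' B' Y)"
    by (subst br_nat) simp_all
  also have "?e \<bullet> (bl A B (A' \<odot> B') \<otimes> \<one> Y) \<bullet> br (A \<odot> B) (A' \<odot> B') Y \<bullet> \<dots> =
      ?e \<bullet> ((bl A B (A' \<odot> B') \<otimes> \<one> Y) \<bullet> br (A \<odot> B) (A' \<odot> B') Y) \<bullet> br A B ((A' \<odot> B') \<odot> Y) \<bullet> (\<one> A \<otimes> \<one> B \<otimes> br A' B' Y)"
    by simp
  also have "\<dots> = ?e \<bullet> (br A (B \<odot> (A' \<odot> B')) Y \<bullet> (\<one> A \<otimes> br B (A' \<odot> B') Y) \<bullet> bl A B ((A' \<odot> B') \<odot> Y)) \<bullet>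
      br A B ((A' \<odot> B') \<odot> Y) \<bullet> (\<one> A \<otimes> \<one> B \<otimes> br A' B' Y)"
    by (simp only: pentagon_right assms mult_obj_closed)
  also have "\<dots> = (br A A' (B \<odot> B') \<otimes> \<one> Y) \<bullet> (((\<one> A \<otimes> exch B A' B') \<otimes> \<one> Y) \<bullet> br A (B \<odot> (A' \<odot> B')) Y) \<bullet>
      (\<one> A \<otimes> (br B (A' \<odot> B') Y \<bullet> (\<one> B \<otimes> br A' B' Y)))"
    by simp
  also have "((\<one> A \<otimes> exch B A' B') \<otimes> \<one> Y) \<bullet> br A (B \<odot> (A' \<odot> B')) Y =
      br A (A' \<odot> (B \<odot> B')) Y \<bullet> (\<one> A \<otimes> exch B A' B' \<otimes> \<one> Y)"
    by (simp add: br_nat)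
  also have "(br A A' (B \<odot> B') \<otimes> \<one> Y) \<bullet> \<dots> \<bullet> (\<one> A \<otimes> (br B (A' \<odot> B') Y \<bullet> (\<one> B \<otimes> br A' B' Y))) =
      (br A A' (B \<odot> B') \<otimes> \<one> Y) \<bullet> br A (A' \<odot> (B \<odot> B')) Y \<bullet>
      (\<one> A \<otimes> ((exch B A' B' \<otimes> \<one> Y) \<bullet> br B (A' \<odot> B') Y \<bullet> (\<one> B \<otimes> br A' B' Y)))"
    by simp
  also have "\<dots> = (br A A' (B \<odot> B') \<otimes> \<one> Y) \<bullet> br A (A' \<odot> (B \<odot> B')) Y \<bullet>
      (\<one> A \<otimes> (br A' (B \<odot> B') Y \<bullet> (\<one> A' \<otimes> br B B' Y) \<bullet> exch B A' (B' \<odot> Y)))"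
    by (simp only: exch_br assms)
  also have "\<dots> = ((br A A' (B \<odot> B') \<otimes> \<one> Y) \<bullet> br A (A' \<odot> (B \<odot> B')) Y \<bullet> (\<one> A \<otimes> br A' (B \<odot> B') Y)) \<bullet>
      (\<one> A \<otimes> \<one> A' \<otimes> br B B' Y) \<bullet> (\<one> A \<otimes> exch B A' (B' \<odot> Y))"
    by simp
  also have "\<dots> = (br (A \<odot> A') (B \<odot> B') Y \<bullet> br A A' ((B \<odot> B') \<odot> Y)) \<bullet>
      (\<one> A \<otimes> \<one> A' \<otimes> br B B' Y) \<bullet> (\<one> A \<otimes> exch B A' (B' \<odot> Y))"
    by (simp only: pentagon assms mult_obj_closed)
  also have "\<dots> = br (A \<odot> A') (B \<odot> B') Y \<bullet> (br A A' ((B \<odot> B') \<odot> Y) \<bullet>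
      (\<one> A \<otimes> \<one> A' \<otimes> br B B' Y)) \<bullet> (\<one> A \<otimes> exch B A' (B' \<odot> Y))"
    by simp
  also have "br A A' ((B \<odot> B') \<odot> Y) \<bullet> (\<one> A \<otimes> \<one> A' \<otimes> br B B' Y) =
      ((\<one> A \<otimes> \<one> A') \<otimes> br B B' Y) \<bullet> br A A' (B \<odot> B' \<odot> Y)"
    by (subst br_nat) simp_all
  finally show ?thesis by simp
qed

text \<open>The compatibility that lifts coassociativity from single variables to products. On
  right-bracketed products both sides consist of the same three exchanges: \<open>D\<close> with
  \<open>A'\<close>, \<open>D\<close> with \<open>B'\<close>, and \<open>B\<close> with
  \<open>A'\<close>.\<close>

lemma middle_sym_assoc:
  assumes [simp]: "A \<in> Obj C" "B \<in> Obj C" "D \<in> Obj C" "A' \<in> Obj C" "B' \<in> Obj C" "D' \<in> Obj C"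
  shows "br (A \<odot> A') (B \<odot> B') (D \<odot> D') \<bullet> (\<one> (A \<odot> A') \<otimes> cm B D B' D') \<bullet> cm A (B \<odot> D) A' (B' \<odot> D') =
    (cm A B A' B' \<otimes> \<one> (D \<odot> D')) \<bullet> cm (A \<odot> B) D (A' \<odot> B') D' \<bullet> (br A B D \<otimes> br A' B' D')"
    (is "?l = ?r")
proof -
  \<comment> \<open>\<open>?u\<close> is the invertible rebracketing from the fully right-bracketed
    product to the common source; \<open>?n\<close> is the form to which both sides are
    reduced.\<close>
  let ?u = "br A (B \<odot> D) (A' \<odot> B' \<odot> D') \<bullet> (\<one> A \<otimes> br B D (A' \<odot> B' \<odot> D'))"
  let ?u' = "(\<one> A \<otimes> bl B D (A' \<odot> B' \<odot> D')) \<bullet> bl A (B \<odot> D) (A' \<odot> B' \<odot> D')"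
  let ?Y = "D \<odot> D'"
  let ?b = "br (A \<odot> A') (B \<odot> B') ?Y"
  let ?n = "?b \<bullet> (\<one> (A \<odot> A') \<otimes> br B B' ?Y) \<bullet> br A A' (B \<odot> B' \<odot> ?Y) \<bullet>
    (\<one> A \<otimes> exch B A' (B' \<odot> ?Y)) \<bullet> (\<one> A \<otimes> \<one> B \<otimes> \<one> A' \<otimes> exch D B' D') \<bullet> (\<one> A \<otimes> \<one> B \<otimes> exch D A' (B' \<odot> D'))"
  have "?l \<bullet> ?u = ?b \<bullet> (\<one> (A \<odot> A') \<otimes> cm B D B' D') \<bullet>
      (cm A (B \<odot> D) A' (B' \<odot> D') \<bullet> br A (B \<odot> D) (A' \<odot> B' \<odot> D')) \<bullet> (\<one> A \<otimes> br B D (A' \<odot> B' \<odot> D'))"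
    by simp
  also have "\<dots> = ?b \<bullet> (\<one> (A \<odot> A') \<otimes> cm B D B' D') \<bullet>
      (br A A' ((B \<odot> D) \<odot> B' \<odot> D') \<bullet> (\<one> A \<otimes> exch (B \<odot> D) A' (B' \<odot> D'))) \<bullet> (\<one> A \<otimes> br B D (A' \<odot> B' \<odot> D'))"
    by (simp only: middle_sym_br assms mult_obj_closed)
  also have "\<dots> = ?b \<bullet> (\<one> (A \<odot> A') \<otimes> cm B D B' D') \<bullet> br A A' ((B \<odot> D) \<odot> B' \<odot> D') \<bullet>
      (\<one> A \<otimes> (exch (B \<odot> D) A' (B' \<odot> D') \<bullet> br B D (A' \<odot> B' \<odot> D')))"
    by simp
  also have "\<dots> = ?b \<bullet> (\<one> (A \<odot> A') \<otimes> cm B D B' D') \<bullet> br A A' ((B \<odot> D) \<odot> B' \<odot> D') \<bullet>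
      (\<one> A \<otimes> ((\<one> A' \<otimes> br B D (B' \<odot> D')) \<bullet> exch B A' (D \<odot> B' \<odot> D') \<bullet> (\<one> B \<otimes> exch D A' (B' \<odot> D'))))"
    by (simp only: exch_mult_left assms mult_obj_closed)
  also have "\<dots> = ?b \<bullet> (\<one> (A \<odot> A') \<otimes> cm B D B' D') \<bullet> (br A A' ((B \<odot> D) \<odot> B' \<odot> D') \<bullet>
      (\<one> A \<otimes> \<one> A' \<otimes> br B D (B' \<odot> D'))) \<bullet> (\<one> A \<otimes> (exch B A' (D \<odot> B' \<odot> D') \<bullet> (\<one> B \<otimes> exch D A' (B' \<odot> D'))))"
    by simp
  also have "br A A' ((B \<odot> D) \<odot> B' \<odot> D') \<bullet> (\<one> A \<otimes> \<one> A' \<otimes> br B D (B' \<odot> D')) =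
      (\<one> (A \<odot> A') \<otimes> br B D (B' \<odot> D')) \<bullet> br A A' (B \<odot> D \<odot> B' \<odot> D')"
    using br_nat[of "\<one> A" "\<one> A'" "br B D (B' \<odot> D')" A A'] by simp
  also have "?b \<bullet> (\<one> (A \<odot> A') \<otimes> cm B D B' D') \<bullet> ((\<one> (A \<odot> A') \<otimes> br B D (B' \<odot> D')) \<bullet> br A A' (B \<odot> D \<odot> B' \<odot> D')) \<bullet>
      (\<one> A \<otimes> (exch B A' (D \<odot> B' \<odot> D') \<bullet> (\<one> B \<otimes> exch D A' (B' \<odot> D')))) =
     ?b \<bullet> (\<one> (A \<odot> A') \<otimes> (cm B D B' D' \<bullet> br B D (B' \<odot> D'))) \<bullet> br A A' (B \<odot> D \<odot> B' \<odot> D') \<bullet>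
      (\<one> A \<otimes> (exch B A' (D \<odot> B' \<odot> D') \<bullet> (\<one> B \<otimes> exch D A' (B' \<odot> D'))))"
    by simp
  also have "\<dots> = ?b \<bullet> (\<one> (A \<odot> A') \<otimes> (br B B' ?Y \<bullet> (\<one> B \<otimes> exch D B' D'))) \<bullet> br A A' (B \<odot> D \<odot> B' \<odot> D') \<bullet>
      (\<one> A \<otimes> (exch B A' (D \<odot> B' \<odot> D') \<bullet> (\<one> B \<otimes> exch D A' (B' \<odot> D'))))"
    by (simp only: middle_sym_br assms)
  also have "\<dots> = ?b \<bullet> (\<one> (A \<odot> A') \<otimes> br B B' ?Y) \<bullet> (((\<one> A \<otimes> \<one> A') \<otimes> \<one> B \<otimes> exch D B' D') \<bullet> br A A' (B \<odot> D \<odot> B' \<odot> D')) \<bullet>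
      (\<one> A \<otimes> (exch B A' (D \<odot> B' \<odot> D') \<bullet> (\<one> B \<otimes> exch D A' (B' \<odot> D'))))"
    by simp
  also have "((\<one> A \<otimes> \<one> A') \<otimes> \<one> B \<otimes> exch D B' D') \<bullet> br A A' (B \<odot> D \<odot> B' \<odot> D') =
      br A A' (B \<odot> B' \<odot> ?Y) \<bullet> (\<one> A \<otimes> \<one> A' \<otimes> \<one> B \<otimes> exch D B' D')"
    by (subst br_nat) simp_all
  also have "?b \<bullet> (\<one> (A \<odot> A') \<otimes> br B B' ?Y) \<bullet> \<dots> \<bullet> (\<one> A \<otimes> (exch B A' (D \<odot> B' \<odot> D') \<bullet> (\<one> B \<otimes> exch D A' (B' \<odot> D')))) =
      ?b \<bullet> (\<one> (A \<odot> A') \<otimes> br B B' ?Y) \<bullet> br A A' (B \<odot> B' \<odot> ?Y) \<bullet>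
      (\<one> A \<otimes> ((\<one> A' \<otimes> \<one> B \<otimes> exch D B' D') \<bullet> exch B A' (D \<odot> B' \<odot> D'))) \<bullet> (\<one> A \<otimes> \<one> B \<otimes> exch D A' (B' \<odot> D'))"
    by simp
  \<comment> \<open>The two sides perform the exchanges of \<open>B\<close> with \<open>A'\<close>
    and of \<open>D\<close> with \<open>B'\<close> in opposite orders. They act on disjoint factors,
    so naturality of \<open>exch\<close> interchanges them.\<close>
  also have "(\<one> A' \<otimes> \<one> B \<otimes> exch D B' D') \<bullet> exch B A' (D \<odot> B' \<odot> D') =
      exch B A' (B' \<odot> ?Y) \<bullet> (\<one> B \<otimes> \<one> A' \<otimes> exch D B' D')"
    using exch_nat[of "\<one> B" "\<one> A'" "exch D B' D'"] by simp
  finally have l: "?l \<bullet> ?u = ?n" by simp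
  have "?r \<bullet> ?u = (cm A B A' B' \<otimes> \<one> ?Y) \<bullet> cm (A \<odot> B) D (A' \<odot> B') D' \<bullet> (\<one> ((A \<odot> B) \<odot> D) \<otimes> br A' B' D') \<bullet>
      ((br A B D \<otimes> \<one> (A' \<odot> B' \<odot> D')) \<bullet> br A (B \<odot> D) (A' \<odot> B' \<odot> D') \<bullet> (\<one> A \<otimes> br B D (A' \<odot> B' \<odot> D')))"
    by simp
  also have "\<dots> = (cm A B A' B' \<otimes> \<one> ?Y) \<bullet> cm (A \<odot> B) D (A' \<odot> B') D' \<bullet> (\<one> ((A \<odot> B) \<odot> D) \<otimes> br A' B' D') \<bullet>
      (br (A \<odot> B) D (A' \<odot> B' \<odot> D') \<bullet> br A B (D \<odot> A' \<odot> B' \<odot> D'))"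
    by (simp only: pentagon assms mult_obj_closed)
  also have "\<dots> = (cm A B A' B' \<otimes> \<one> ?Y) \<bullet> cm (A \<odot> B) D (A' \<odot> B') D' \<bullet> (((\<one> (A \<odot> B) \<otimes> \<one> D) \<otimes> br A' B' D') \<bullet>
      br (A \<odot> B) D (A' \<odot> B' \<odot> D')) \<bullet> br A B (D \<odot> A' \<odot> B' \<odot> D')"
    by simp
  also have "((\<one> (A \<odot> B) \<otimes> \<one> D) \<otimes> br A' B' D') \<bullet> br (A \<odot> B) D (A' \<odot> B' \<odot> D') =
      br (A \<odot> B) D ((A' \<odot> B') \<odot> D') \<bullet> (\<one> (A \<odot> B) \<otimes> \<one> D \<otimes> br A' B' D')"
    by (subst br_nat) simp_all
  also have "(cm A B A' B' \<otimes> \<one> ?Y) \<bullet> cm (A \<odot> B) D (A' \<odot> B') D' \<bullet> \<dots> \<bullet> br A B (D \<odot> A' \<odot> B' \<odot> D') =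
      (cm A B A' B' \<otimes> \<one> ?Y) \<bullet> (cm (A \<odot> B) D (A' \<odot> B') D' \<bullet> br (A \<odot> B) D ((A' \<odot> B') \<odot> D')) \<bullet>
      (\<one> (A \<odot> B) \<otimes> \<one> D \<otimes> br A' B' D') \<bullet> br A B (D \<odot> A' \<odot> B' \<odot> D')"
    by simp
  also have "\<dots> = (cm A B A' B' \<otimes> \<one> ?Y) \<bullet> (br (A \<odot> B) (A' \<odot> B') ?Y \<bullet> (\<one> (A \<odot> B) \<otimes> exch D (A' \<odot> B') D')) \<bullet>
      (\<one> (A \<odot> B) \<otimes> \<one> D \<otimes> br A' B' D') \<bullet> br A B (D \<odot> A' \<odot> B' \<odot> D')"
    by (simp only: middle_sym_br assms mult_obj_closed)
  also have "\<dots> = (cm A B A' B' \<otimes> \<one> ?Y) \<bullet> br (A \<odot> B) (A' \<odot> B') ?Y \<bullet>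
      (\<one> (A \<odot> B) \<otimes> (exch D (A' \<odot> B') D' \<bullet> (\<one> D \<otimes> br A' B' D'))) \<bullet> br A B (D \<odot> A' \<odot> B' \<odot> D')"
    by simp
  also have "\<dots> = (cm A B A' B' \<otimes> \<one> ?Y) \<bullet> br (A \<odot> B) (A' \<odot> B') ?Y \<bullet>
      (\<one> (A \<odot> B) \<otimes> (br A' B' (D \<odot> D') \<bullet> (\<one> A' \<otimes> exch D B' D') \<bullet> exch D A' (B' \<odot> D'))) \<bullet> br A B (D \<odot> A' \<odot> B' \<odot> D')"
    by (simp only: exch_mult_right assms)
  also have "\<dots> = (cm A B A' B' \<otimes> \<one> ?Y) \<bullet> br (A \<odot> B) (A' \<odot> B') ?Y \<bullet> (\<one> (A \<odot> B) \<otimes> br A' B' ?Y) \<bullet>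
      (((\<one> A \<otimes> \<one> B) \<otimes> ((\<one> A' \<otimes> exch D B' D') \<bullet> exch D A' (B' \<odot> D'))) \<bullet> br A B (D \<odot> A' \<odot> B' \<odot> D'))"
    by simp
  also have "((\<one> A \<otimes> \<one> B) \<otimes> ((\<one> A' \<otimes> exch D B' D') \<bullet> exch D A' (B' \<odot> D'))) \<bullet> br A B (D \<odot> A' \<odot> B' \<odot> D') =
      br A B (A' \<odot> B' \<odot> ?Y) \<bullet> (\<one> A \<otimes> \<one> B \<otimes> ((\<one> A' \<otimes> exch D B' D') \<bullet> exch D A' (B' \<odot> D')))"
    by (subst br_nat) simp_all
  also have "(cm A B A' B' \<otimes> \<one> ?Y) \<bullet> br (A \<odot> B) (A' \<odot> B') ?Y \<bullet> (\<one> (A \<odot> B) \<otimes> br A' B' ?Y) \<bullet> \<dots> =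
      ((cm A B A' B' \<otimes> \<one> ?Y) \<bullet> br (A \<odot> B) (A' \<odot> B') ?Y \<bullet> (\<one> (A \<odot> B) \<otimes> br A' B' ?Y) \<bullet> br A B (A' \<odot> B' \<odot> ?Y)) \<bullet>
      (\<one> A \<otimes> \<one> B \<otimes> ((\<one> A' \<otimes> exch D B' D') \<bullet> exch D A' (B' \<odot> D')))"
    by simp
  also have "\<dots> = (?b \<bullet> (\<one> (A \<odot> A') \<otimes> br B B' ?Y) \<bullet> br A A' (B \<odot> B' \<odot> ?Y) \<bullet> (\<one> A \<otimes> exch B A' (B' \<odot> ?Y))) \<bullet>
      (\<one> A \<otimes> \<one> B \<otimes> ((\<one> A' \<otimes> exch D B' D') \<bullet> exch D A' (B' \<odot> D')))"
    by (simp only: middle_sym_mult_Id assms mult_obj_closed)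
  also have "\<dots> = ?n" by simp
  finally have "?l \<bullet> ?u = ?r \<bullet> ?u" using l by simp
  then show ?thesis
    by (rule epi_cancel[where u' = ?u']) simp_all
qed

text \<open>Lifts symmetry from single variables to products. As before, both sides are reduced to
  one form \<open>?n\<close> after right bracketing.\<close>

lemma sym_middle_sym:
  assumes [simp]: "A \<in> Obj C" "B \<in> Obj C" "A' \<in> Obj C" "B' \<in> Obj C"
  shows "\<c> (A \<odot> B) (A' \<odot> B') \<bullet> cm A A' B B' = cm A' A B' B \<bullet> (\<c> A A' \<otimes> \<c> B B')" (is "?l = ?r")
proof -
  let ?u = "br A A' (B \<odot> B')"
  let ?n = "br A' B' (A \<odot> B) \<bullet> (\<one> A' \<otimes> exch A B' B) \<bullet> exch A A' (B' \<odot> B) \<bullet> (\<one> A \<otimes> \<one> A' \<otimes> \<c> B B')"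
  have "?l \<bullet> ?u = \<c> (A \<odot> B) (A' \<odot> B') \<bullet> (cm A A' B B' \<bullet> ?u)" by simp
  also have "\<dots> = \<c> (A \<odot> B) (A' \<odot> B') \<bullet> (br A B (A' \<odot> B') \<bullet> (\<one> A \<otimes> exch A' B B'))"
    by (simp only: middle_sym_br assms)
  also have "\<dots> = (\<c> (A \<odot> B) (A' \<odot> B') \<bullet> br A B (A' \<odot> B')) \<bullet> (\<one> A \<otimes> exch A' B B')" by simp
  also have "\<dots> = (exch A (A' \<odot> B') B \<bullet> (\<one> A \<otimes> \<c> B (A' \<odot> B'))) \<bullet> (\<one> A \<otimes> exch A' B B')"
    by (simp only: sym_mult_left assms mult_obj_closed)
  also have "\<dots> = exch A (A' \<odot> B') B \<bullet> (\<one> A \<otimes> (\<c> B (A' \<odot> B') \<bullet> exch A' B B'))" by simp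
  \<comment> \<open>Here the exchange of \<open>A'\<close> and \<open>B\<close> made by
    \<open>cm\<close> is undone by the symmetry of the blocks.\<close>
  also have "\<dots> = exch A (A' \<odot> B') B \<bullet> (\<one> A \<otimes> (br A' B' B \<bullet> (\<one> A' \<otimes> \<c> B B')))"
    by (simp only: sym_mult_right assms mult_obj_closed)
  also have "\<dots> = (exch A (A' \<odot> B') B \<bullet> (\<one> A \<otimes> br A' B' B)) \<bullet> (\<one> A \<otimes> \<one> A' \<otimes> \<c> B B')" by simp
  also have "\<dots> = (br A' B' (A \<odot> B) \<bullet> (\<one> A' \<otimes> exch A B' B) \<bullet> exch A A' (B' \<odot> B)) \<bullet> (\<one> A \<otimes> \<one> A' \<otimes> \<c> B B')"
    by (simp only: exch_mult_right assms)
  finally have l: "?l \<bullet> ?u = ?n" by simp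
  have "?r \<bullet> ?u = cm A' A B' B \<bullet> (\<one> (A' \<odot> A) \<otimes> \<c> B B') \<bullet> br A' A (B \<odot> B') \<bullet> exch A A' (B \<odot> B')"
    by (simp add: exch_def)
  also have "\<dots> = cm A' A B' B \<bullet> (((\<one> A' \<otimes> \<one> A) \<otimes> \<c> B B') \<bullet> br A' A (B \<odot> B')) \<bullet> exch A A' (B \<odot> B')" by simp
  also have "((\<one> A' \<otimes> \<one> A) \<otimes> \<c> B B') \<bullet> br A' A (B \<odot> B') = br A' A (B' \<odot> B) \<bullet> (\<one> A' \<otimes> \<one> A \<otimes> \<c> B B')"
    by (subst br_nat) simp_all
  also have "cm A' A B' B \<bullet> \<dots> \<bullet> exch A A' (B \<odot> B') =
      (cm A' A B' B \<bullet> br A' A (B' \<odot> B)) \<bullet> ((\<one> A' \<otimes> \<one> A \<otimes> \<c> B B') \<bullet> exch A A' (B \<odot> B'))" by simp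
  also have "(\<one> A' \<otimes> \<one> A \<otimes> \<c> B B') \<bullet> exch A A' (B \<odot> B') = exch A A' (B' \<odot> B) \<bullet> (\<one> A \<otimes> \<one> A' \<otimes> \<c> B B')"
    using exch_nat[of "\<one> A" "\<one> A'" "\<c> B B'"] by simp
  also have "cm A' A B' B \<bullet> br A' A (B' \<odot> B) = br A' B' (A \<odot> B) \<bullet> (\<one> A' \<otimes> exch A B' B)"
    by (simp only: middle_sym_br assms)
  finally have "?r \<bullet> ?u = ?n" by simp
  with l have "?l \<bullet> ?u = ?r \<bullet> ?u" by simp
  then show ?thesis
    by (rule epi_cancel[OF _ b_right_left]) simp_all
qed

lemma sigma_middle_sym:
  assumes [simp]: "A \<in> Obj C" "B \<in> Obj C"
  shows "\<sigma> (A \<odot> B) \<bullet> (\<sigma> \<I> \<otimes> \<one> (A \<odot> B)) \<bullet> cm \<I> A \<I> B = \<sigma> A \<otimes> \<sigma> B" (is "?l = ?r")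
proof -
  let ?u = "br \<I> A (\<I> \<odot> B)"
  \<comment> \<open>Reading \<sigma> at \<I> as \<delta> at \<I> makes the triangle
    applicable.\<close>
  have "?l \<bullet> ?u = \<sigma> (A \<odot> B) \<bullet> (\<delta> \<I> \<otimes> \<one> (A \<odot> B)) \<bullet> (cm \<I> A \<I> B \<bullet> ?u)"
    by (simp add: sigma_unit)
  also have "\<dots> = \<sigma> (A \<odot> B) \<bullet> (\<delta> \<I> \<otimes> \<one> (A \<odot> B)) \<bullet> (br \<I> \<I> (A \<odot> B) \<bullet> (\<one> \<I> \<otimes> exch A \<I> B))"
    by (simp only: middle_sym_br assms unit_obj_closed)
  also have "\<dots> = \<sigma> (A \<odot> B) \<bullet> ((\<delta> \<I> \<otimes> \<one> (A \<odot> B)) \<bullet> br \<I> \<I> (A \<odot> B)) \<bullet> (\<one> \<I> \<otimes> exch A \<I> B)" by simp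
  also have "\<dots> = \<sigma> (A \<odot> B) \<bullet> (\<one> \<I> \<otimes> \<sigma> (A \<odot> B)) \<bullet> (\<one> \<I> \<otimes> exch A \<I> B)"
    by (simp only: triangle assms mult_obj_closed unit_obj_closed)
  also have "\<dots> = \<sigma> (A \<odot> B) \<bullet> (\<one> \<I> \<otimes> \<one> A \<otimes> \<sigma> B)" by (simp add: sigma_exch)
  also have "\<dots> = (\<one> A \<otimes> \<sigma> B) \<bullet> \<sigma> (A \<odot> \<I> \<odot> B)" by (rule sigma_nat) simp_all
  also have "\<dots> = (\<one> A \<otimes> \<sigma> B) \<bullet> ((\<sigma> A \<otimes> \<one> (\<I> \<odot> B)) \<bullet> ?u)" by (simp add: sigma_mult)
  also have "\<dots> = ?r \<bullet> ?u" by simp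
  finally show ?thesis
    by (rule epi_cancel[OF _ b_right_left]) simp_all
qed

lemma sym_delta_inv:
  assumes [simp]: "A \<in> Obj C"
  shows "\<c> A \<I> \<bullet> \<delta>\<^sup>i A = \<sigma>\<^sup>i A"
proof -
  have "\<sigma> A \<bullet> \<c> A \<I> \<bullet> \<delta>\<^sup>i A = \<sigma> A \<bullet> \<sigma>\<^sup>i A" by (simp add: Comp_reassoc[OF sigma_sym])
  then show ?thesis by (rule mono_cancel[OF _ sigma_inv_sigma]) simp_all
qed

lemma sym_sigma_inv:
  assumes [simp]: "A \<in> Obj C"
  shows "\<c> \<I> A \<bullet> \<sigma>\<^sup>i A = \<delta>\<^sup>i A"
  by (simp add: sym_delta_inv[symmetric])

lemma has_section_middle_sym:
  assumes "A \<in> Obj C" "B \<in> Obj C" "D \<in> Obj C" "E \<in> Obj C"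
  shows "has_section (cm A B D E)"
  using assms by (intro has_sectionI[of _ "cm A D B E"]) (simp_all add: middle_sym_inverse)

end

section \<open>Splitting a product of distinct objects\<close>

context relevant_category
begin

lemma diag_arr [simp]:
  assumes "A \<in> Obj C"
  shows "\<w> A \<in> Arr C" "Dom C (\<w> A) = A" "Cod C (\<w> A) = A \<odot> A"
  using diag_hom[OF assms] by (auto simp: hom_def)

lemma diag_nat:
  assumes "f \<in> Arr C"
  shows "\<w> (Cod C f) \<bullet> f = (f \<otimes> f) \<bullet> \<w> (Dom C f)"
  using diag_natural[of f "Dom C f" "Cod C f"] assms by (simp add: hom_def)

lemma diag_unit: "\<w> \<I> = \<sigma>\<^sup>i \<I>"
proof -
  have "\<sigma> \<I> \<bullet> \<w> \<I> = \<sigma> \<I> \<bullet> \<sigma>\<^sup>i \<I>" by (simp add: sigma_diag_unit)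
  then show ?thesis by (rule mono_cancel[OF _ sigma_inv_sigma]) simp_all
qed

lemma middle_sym_diag:
  assumes [simp]: "A \<in> Obj C" "B \<in> Obj C"
  shows "cm A A B B \<bullet> (\<w> A \<otimes> \<w> B) = \<w> (A \<odot> B)"
  by (simp add: diag_mult[symmetric] Comp_reassoc[OF middle_sym_inverse])

section \<open>Splitting a single variable, present or absent\<close>

definition var_obj :: "'o \<Rightarrow> bool \<Rightarrow> 'o" where
  "var_obj A p = (if p then A else \<I>)"

text \<open>The flags tell whether the variable occurs in the left and in the right target. If both
  are false, the choice between the two inverse unit arrows and the diagonal of \<I> is immaterial:
  they coincide by \<open>delta_inv_unit\<close> and \<open>diag_unit\<close>.\<close>

definition var_split :: "'o \<Rightarrow> bool \<Rightarrow> bool \<Rightarrow> 'a" where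
  "var_split A p q = (if p then if q then \<w> A else \<delta>\<^sup>i A else \<sigma>\<^sup>i (var_obj A q))"

lemma var_obj_False [simp]: "var_obj A False = \<I>"
  by (simp add: var_obj_def)

lemma var_obj_True [simp]: "var_obj A True = A"
  by (simp add: var_obj_def)

lemma var_obj_Obj [simp]: "A \<in> Obj C \<Longrightarrow> var_obj A p \<in> Obj C"
  by (simp add: var_obj_def)

lemma var_split_arr [simp]:
  assumes "A \<in> Obj C"
  shows "var_split A p q \<in> Arr C" "Dom C (var_split A p q) = var_obj A (p \<or> q)"
    "Cod C (var_split A p q) = var_obj A p \<odot> var_obj A q"
  using assms by (auto simp: var_split_def var_obj_def)

lemma var_split_False_left: "var_split A False q = \<sigma>\<^sup>i (var_obj A q)"
  by (simp add: var_split_def)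

lemma var_split_False_right: "A \<in> Obj C \<Longrightarrow> var_split A p False = \<delta>\<^sup>i (var_obj A p)"
  by (auto simp: var_split_def delta_inv_unit)

lemma var_split_assoc:
  assumes [simp]: "A \<in> Obj C"
  shows "br (var_obj A p) (var_obj A q) (var_obj A r) \<bullet> (\<one> (var_obj A p) \<otimes> var_split A q r) \<bullet> var_split A p (q \<or> r) =
    (var_split A p q \<otimes> \<one> (var_obj A r)) \<bullet> var_split A (p \<or> q) r" (is "?l = ?r")
proof (cases r)
  case False
  then have "?l = \<delta>\<^sup>i (var_obj A p \<odot> var_obj A q) \<bullet> var_split A p q"
    by (simp add: var_split_False_right Comp_reassoc[OF br_delta_inv])
  also have "\<dots> = ?r"
    using False by (simp add: var_split_False_right delta_inv_nat)
  finally show ?thesis .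
next
  case r: True
  show ?thesis
  proof (cases q)
    case False
    with r show ?thesis
      by (simp add: var_split_False_left var_split_False_right Comp_reassoc[OF br_triangle_inv])
  next
    case q: True
    show ?thesis
    proof (cases p)
      case False
      have "br \<I> A A \<bullet> \<sigma>\<^sup>i (A \<odot> A) \<bullet> \<w> A = (\<sigma>\<^sup>i A \<otimes> \<one> A) \<bullet> \<w> A"
        by (simp add: Comp_reassoc[OF br_sigma_inv])
      then show ?thesis
        using False q r by (simp add: var_split_False_left var_split_def sigma_inv_nat)
    next
      case True
      with q r show ?thesis by (simp add: var_split_def diag_assoc)
    qed
  qed
qed

lemma sym_var_split:
  assumes [simp]: "A \<in> Obj C"
  shows "\<c> (var_obj A p) (var_obj A q) \<bullet> var_split A p q = var_split A q p"
  using sym_delta_inv[of \<I>]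
  by (auto simp: var_split_def sym_diag sym_delta_inv sym_sigma_inv delta_inv_unit)

lemma var_split_diag: "A \<in> Obj C \<Longrightarrow> var_split A p p = \<w> (var_obj A p)"
  by (auto simp: var_split_def diag_unit)

lemma has_section_var_split: "A \<in> Obj C \<Longrightarrow> \<not> (p \<and> q) \<Longrightarrow> has_section (var_split A p q)"
  by (auto simp: var_split_def has_section_primitive)

text \<open>
  The product of those \<open>X k\<close>, \<open>k < n\<close>, with \<open>k \<in> S\<close>. Absent factors are replaced by the unit, so that
  the recursion is the same for all \<open>S\<close>.
\<close>

primrec prod_obj :: "(nat \<Rightarrow> 'o) \<Rightarrow> nat \<Rightarrow> nat set \<Rightarrow> 'o" where
  "prod_obj X 0 S = \<I>"
| "prod_obj X (Suc n) S = var_obj (X n) (n \<in> S) \<odot> prod_obj X n S"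

text \<open>Every variable is split separately; \<open>cm\<close> then gathers the left copies in
  front of the right ones.\<close>

primrec prod_split :: "(nat \<Rightarrow> 'o) \<Rightarrow> nat \<Rightarrow> nat set \<Rightarrow> nat set \<Rightarrow> 'a" where
  "prod_split X 0 S T = \<sigma>\<^sup>i \<I>"
| "prod_split X (Suc n) S T =
    cm (var_obj (X n) (n \<in> S)) (var_obj (X n) (n \<in> T)) (prod_obj X n S) (prod_obj X n T) \<bullet>
    (var_split (X n) (n \<in> S) (n \<in> T) \<otimes> prod_split X n S T)"

text \<open>The product over the empty set is an iterated product of units rather than \<I> itself;
  this arrow collapses it.\<close>

primrec prod_unit :: "(nat \<Rightarrow> 'o) \<Rightarrow> nat \<Rightarrow> 'a" where
  "prod_unit X 0 = \<one> \<I>"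
| "prod_unit X (Suc n) = \<sigma> \<I> \<bullet> (\<one> \<I> \<otimes> prod_unit X n)"

text \<open>The highest variable stands leftmost. Units above \<open>k\<close> are removed by
  \<sigma> on the left; those below \<open>k\<close> are collapsed and removed by \<delta> on the
  right.\<close>

primrec prod_var :: "(nat \<Rightarrow> 'o) \<Rightarrow> nat \<Rightarrow> nat \<Rightarrow> 'a" where
  "prod_var X 0 k = \<one> \<I>"
| "prod_var X (Suc n) k =
    (if k = n then \<delta> (X n) \<bullet> (\<one> (X n) \<otimes> prod_unit X n) else \<sigma> (X k) \<bullet> (\<one> \<I> \<otimes> prod_var X n k))"

lemma prod_obj_cong: "(\<And>k. k < n \<Longrightarrow> k \<in> S \<longleftrightarrow> k \<in> T) \<Longrightarrow> prod_obj X n S = prod_obj X n T"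
  by (induction n) auto

lemma prod_obj_Obj [simp]: "range X \<subseteq> Obj C \<Longrightarrow> prod_obj X n S \<in> Obj C"
  by (induction n) (simp_all add: image_subset_iff)

lemma prod_split_arr [simp]:
  assumes "range X \<subseteq> Obj C"
  shows "prod_split X n S T \<in> Arr C" "Dom C (prod_split X n S T) = prod_obj X n (S \<union> T)"
    "Cod C (prod_split X n S T) = prod_obj X n S \<odot> prod_obj X n T"
proof (induction n)
  case (Suc n)
  have [simp]: "X n \<in> Obj C" using assms by auto
  {
    case 1 then show ?case using Suc assms by simp
  next
    case 2 then show ?case using Suc assms by simp
  next
    case 3 then show ?case using Suc assms by simp
  }
qed auto

lemma prod_unit_arr [simp]:
  "prod_unit X n \<in> Arr C" "Dom C (prod_unit X n) = prod_obj X n {}" "Cod C (prod_unit X n) = \<I>"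
  by (induction n) auto

lemma prod_var_arr [simp]:
  assumes "range X \<subseteq> Obj C" "k < n"
  shows "prod_var X n k \<in> Arr C \<and> Dom C (prod_var X n k) = prod_obj X n {k} \<and> Cod C (prod_var X n k) = X k"
  using assms(2)
proof (induction n)
  case (Suc n)
  have [simp]: "X j \<in> Obj C" for j using assms by auto
  have "prod_obj X n {n} = prod_obj X n {}" by (rule prod_obj_cong) auto
  then show ?case using Suc by (cases "k = n") auto
qed simp

text \<open>Naturality of \<open>cm\<close> moves all splittings to the right,
  \<open>middle_sym_assoc\<close> rearranges the interchanges, and what remains is
  \<open>var_split_assoc\<close> in one factor and the induction hypothesis in the other.\<close>

lemma prod_split_assoc:
  assumes X: "range X \<subseteq> Obj C"
  shows "br (prod_obj X n S) (prod_obj X n T) (prod_obj X n U) \<bullet>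
      (\<one> (prod_obj X n S) \<otimes> prod_split X n T U) \<bullet> prod_split X n S (T \<union> U) =
    (prod_split X n S T \<otimes> \<one> (prod_obj X n U)) \<bullet> prod_split X n (S \<union> T) U"
proof (induction n)
  case 0
  \<comment> \<open>The empty product is \<I>, so the claim is that for one variable absent from all
    three sets.\<close>
  show ?case using var_split_assoc[of \<I> False False False] by (simp add: var_split_False_left)
next
  case (Suc n)
  have [simp]: "X j \<in> Obj C" for j using X by auto
  let ?V = "\<lambda>S. var_obj (X n) (n \<in> S)" and ?P = "prod_obj X n"
  let ?v = "\<lambda>S T. var_split (X n) (n \<in> S) (n \<in> T)" and ?d = "prod_split X n"
  let ?B = "br (prod_obj X (Suc n) S) (prod_obj X (Suc n) T) (prod_obj X (Suc n) U)"
  have "?B \<bullet> (\<one> (prod_obj X (Suc n) S) \<otimes> prod_split X (Suc n) T U) \<bullet> prod_split X (Suc n) S (T \<union> U) =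
      ?B \<bullet> (\<one> (?V S \<odot> ?P S) \<otimes> cm (?V T) (?V U) (?P T) (?P U)) \<bullet>
      (((\<one> (?V S) \<otimes> \<one> (?P S)) \<otimes> ?v T U \<otimes> ?d T U) \<bullet> cm (?V S) (?V (T \<union> U)) (?P S) (?P (T \<union> U))) \<bullet>
      (?v S (T \<union> U) \<otimes> ?d S (T \<union> U))"
    using X by simp
  also have "((\<one> (?V S) \<otimes> \<one> (?P S)) \<otimes> ?v T U \<otimes> ?d T U) \<bullet> cm (?V S) (?V (T \<union> U)) (?P S) (?P (T \<union> U)) =
      cm (?V S) (?V T \<odot> ?V U) (?P S) (?P T \<odot> ?P U) \<bullet> ((\<one> (?V S) \<otimes> ?v T U) \<otimes> \<one> (?P S) \<otimes> ?d T U)"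
    using X middle_sym_nat[of "\<one> (?V S)" "?v T U" "\<one> (?P S)" "?d T U"] by simp
  also have "?B \<bullet> (\<one> (?V S \<odot> ?P S) \<otimes> cm (?V T) (?V U) (?P T) (?P U)) \<bullet> \<dots> \<bullet> (?v S (T \<union> U) \<otimes> ?d S (T \<union> U)) =
      (br (?V S \<odot> ?P S) (?V T \<odot> ?P T) (?V U \<odot> ?P U) \<bullet> (\<one> (?V S \<odot> ?P S) \<otimes> cm (?V T) (?V U) (?P T) (?P U)) \<bullet>
        cm (?V S) (?V T \<odot> ?V U) (?P S) (?P T \<odot> ?P U)) \<bullet>
      (((\<one> (?V S) \<otimes> ?v T U) \<bullet> ?v S (T \<union> U)) \<otimes> ((\<one> (?P S) \<otimes> ?d T U) \<bullet> ?d S (T \<union> U)))"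
    using X by simp
  also have "\<dots> = ((cm (?V S) (?V T) (?P S) (?P T) \<otimes> \<one> (?V U \<odot> ?P U)) \<bullet>
      cm (?V S \<odot> ?V T) (?V U) (?P S \<odot> ?P T) (?P U) \<bullet> (br (?V S) (?V T) (?V U) \<otimes> br (?P S) (?P T) (?P U))) \<bullet>
      (((\<one> (?V S) \<otimes> ?v T U) \<bullet> ?v S (T \<union> U)) \<otimes> ((\<one> (?P S) \<otimes> ?d T U) \<bullet> ?d S (T \<union> U)))"
    using X by (subst middle_sym_assoc) simp_all
  also have "\<dots> = (cm (?V S) (?V T) (?P S) (?P T) \<otimes> \<one> (?V U \<odot> ?P U)) \<bullet>
      cm (?V S \<odot> ?V T) (?V U) (?P S \<odot> ?P T) (?P U) \<bullet>
      ((br (?V S) (?V T) (?V U) \<bullet> (\<one> (?V S) \<otimes> ?v T U) \<bullet> ?v S (T \<union> U)) \<otimes>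
       (br (?P S) (?P T) (?P U) \<bullet> (\<one> (?P S) \<otimes> ?d T U) \<bullet> ?d S (T \<union> U)))"
    using X by simp
  also have "br (?V S) (?V T) (?V U) \<bullet> (\<one> (?V S) \<otimes> ?v T U) \<bullet> ?v S (T \<union> U) = (?v S T \<otimes> \<one> (?V U)) \<bullet> ?v (S \<union> T) U"
    using var_split_assoc[of "X n" "n \<in> S" "n \<in> T" "n \<in> U"] by simp
  also note Suc.IH
  also have "(cm (?V S) (?V T) (?P S) (?P T) \<otimes> \<one> (?V U \<odot> ?P U)) \<bullet>
      cm (?V S \<odot> ?V T) (?V U) (?P S \<odot> ?P T) (?P U) \<bullet>
      (((?v S T \<otimes> \<one> (?V U)) \<bullet> ?v (S \<union> T) U) \<otimes> ((?d S T \<otimes> \<one> (?P U)) \<bullet> ?d (S \<union> T) U)) =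
      (cm (?V S) (?V T) (?P S) (?P T) \<otimes> \<one> (?V U \<odot> ?P U)) \<bullet>
      (cm (?V S \<odot> ?V T) (?V U) (?P S \<odot> ?P T) (?P U) \<bullet>
       ((?v S T \<otimes> \<one> (?V U)) \<otimes> (?d S T \<otimes> \<one> (?P U)))) \<bullet> (?v (S \<union> T) U \<otimes> ?d (S \<union> T) U)"
    using X by simp
  also have "cm (?V S \<odot> ?V T) (?V U) (?P S \<odot> ?P T) (?P U) \<bullet> ((?v S T \<otimes> \<one> (?V U)) \<otimes> (?d S T \<otimes> \<one> (?P U))) =
      ((?v S T \<otimes> ?d S T) \<otimes> \<one> (?V U) \<otimes> \<one> (?P U)) \<bullet> cm (?V (S \<union> T)) (?V U) (?P (S \<union> T)) (?P U)"
    using X middle_sym_nat[of "?v S T" "\<one> (?V U)" "?d S T" "\<one> (?P U)"] by simp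
  finally show ?case using X by simp
qed

lemma sym_prod_split:
  assumes X: "range X \<subseteq> Obj C"
  shows "\<c> (prod_obj X n S) (prod_obj X n T) \<bullet> prod_split X n S T = prod_split X n T S"
proof (induction n)
  case 0
  show ?case using sym_delta_inv[of \<I>] by (simp add: delta_inv_unit)
next
  case (Suc n)
  have [simp]: "X j \<in> Obj C" for j using X by auto
  show ?case
    using X Suc by (simp add: Comp_reassoc[OF sym_middle_sym] sym_var_split)
qed

lemma prod_split_diag:
  assumes X: "range X \<subseteq> Obj C"
  shows "prod_split X n S S = \<w> (prod_obj X n S)"
proof (induction n)
  case (Suc n)
  have [simp]: "X j \<in> Obj C" for j using X by auto
  show ?case using X Suc by (simp add: var_split_diag middle_sym_diag)
qed (simp add: diag_unit)

text \<open>Naturality of \<open>cm\<close> brings \<open>prod_unit\<close> next to the smaller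
  splitting, and \<open>sigma_middle_sym\<close> separates the new variable from the rest.\<close>

lemma prod_split_unit:
  assumes X: "range X \<subseteq> Obj C"
  shows "\<sigma> (prod_obj X n S) \<bullet> (prod_unit X n \<otimes> \<one> (prod_obj X n S)) \<bullet> prod_split X n {} S = \<one> (prod_obj X n S)"
proof (induction n)
  case (Suc n)
  have [simp]: "X j \<in> Obj C" for j using X by auto
  let ?V = "var_obj (X n) (n \<in> S)" and ?P = "prod_obj X n S"
  have "\<sigma> (prod_obj X (Suc n) S) \<bullet> (prod_unit X (Suc n) \<otimes> \<one> (prod_obj X (Suc n) S)) \<bullet> prod_split X (Suc n) {} S =
      \<sigma> (?V \<odot> ?P) \<bullet> (\<sigma> \<I> \<otimes> \<one> (?V \<odot> ?P)) \<bullet> (((\<one> \<I> \<otimes> prod_unit X n) \<otimes> \<one> ?V \<otimes> \<one> ?P) \<bullet>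
      cm \<I> ?V (prod_obj X n {}) ?P) \<bullet> (\<sigma>\<^sup>i ?V \<otimes> prod_split X n {} S)"
    using X by (simp add: var_split_False_left)
  also have "((\<one> \<I> \<otimes> prod_unit X n) \<otimes> \<one> ?V \<otimes> \<one> ?P) \<bullet> cm \<I> ?V (prod_obj X n {}) ?P =
      cm \<I> ?V \<I> ?P \<bullet> ((\<one> \<I> \<otimes> \<one> ?V) \<otimes> prod_unit X n \<otimes> \<one> ?P)"
    using X middle_sym_nat[of "\<one> \<I>" "\<one> ?V" "prod_unit X n" "\<one> ?P"] by simp
  also have "\<sigma> (?V \<odot> ?P) \<bullet> (\<sigma> \<I> \<otimes> \<one> (?V \<odot> ?P)) \<bullet> \<dots> \<bullet> (\<sigma>\<^sup>i ?V \<otimes> prod_split X n {} S) =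
      (\<sigma> (?V \<odot> ?P) \<bullet> (\<sigma> \<I> \<otimes> \<one> (?V \<odot> ?P)) \<bullet> cm \<I> ?V \<I> ?P) \<bullet>
      (\<sigma>\<^sup>i ?V \<otimes> ((prod_unit X n \<otimes> \<one> ?P) \<bullet> prod_split X n {} S))"
    using X by simp
  also have "\<dots> = (\<sigma> ?V \<otimes> \<sigma> ?P) \<bullet> (\<sigma>\<^sup>i ?V \<otimes> ((prod_unit X n \<otimes> \<one> ?P) \<bullet> prod_split X n {} S))"
    using X by (subst sigma_middle_sym) simp_all
  also have "\<dots> = \<one> ?V \<otimes> \<one> ?P" using X Suc by simp
  finally show ?case using X by simp
qed simp

text \<open>Disjointness excludes the diagonal from every \<open>var_split\<close>, leaving only
  inverse unit arrows and interchanges.\<close>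

lemma has_section_prod_split:
  assumes X: "range X \<subseteq> Obj C" and "S \<inter> T = {}"
  shows "has_section (prod_split X n S T)"
proof (induction n)
  case (Suc n)
  have [simp]: "X j \<in> Obj C" for j using X by auto
  have "has_section (var_split (X n) (n \<in> S) (n \<in> T))"
    using assms(2) by (intro has_section_var_split) auto
  then show ?case
    using X Suc by (auto intro!: has_section_Comp has_section_Mult has_section_middle_sym)
qed (simp add: has_section_primitive)

lemma has_section_prod_unit: "has_section (prod_unit X n)"
  by (induction n) (auto intro!: has_section_Comp has_section_Mult has_section_primitive has_section_Id)

lemma has_section_prod_var:
  assumes X: "range X \<subseteq> Obj C" and "k < n"
  shows "has_section (prod_var X n k)"
  using assms(2)
proof (induction n)
  case (Suc n)
  have [simp]: "X j \<in> Obj C" for j using X by auto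
  show ?case
    using X Suc by (auto intro!: has_section_Comp has_section_Mult has_section_primitive has_section_Id
        has_section_prod_unit)
qed simp

end

section \<open>Coherence\<close>

text \<open>The counterpart of \<open>slice\<close> for valuations. It is not restricted to an
  interval, so that nested shifts compose on the nose; equality up to the arity is handled by
  congruence lemmas.\<close>

definition shift :: "nat \<Rightarrow> (nat \<Rightarrow> 'v) \<Rightarrow> nat \<Rightarrow> 'v" where
  "shift k v = (\<lambda>i. v (k + i))"

lemma shift_shift [simp]: "shift k (shift l v) = shift (l + k) v"
  by (simp add: shift_def add.assoc)

lemma shift_0 [simp]: "shift 0 v = v"
  by (simp add: shift_def)

lemma shift_image: "shift k v ` {1..l} = v ` {k + 1..k + l}"
proof -
  have "shift k v ` {1..l} = v ` (+) k ` {1..l}"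
    unfolding shift_def image_image ..
  also have "(+) k ` {1..l} = {k + 1..k + l}"
    by (simp only: image_add_atLeastAtMost add.commute)
  finally show ?thesis .
qed

lemma image_arity_Mult:
  "f ` {1..arity (F \<boxdot> G)} = f ` {1..arity F} \<union> shift (arity F) f ` {1..arity G}"
proof -
  have "{1..arity (F \<boxdot> G)} = {1..arity F} \<union> {arity F + 1..arity F + arity G}" by auto
  then show ?thesis unfolding shift_image by (simp only: image_Un)
qed

definition labels :: "shape \<Rightarrow> (nat \<Rightarrow> 'v) \<Rightarrow> 'v set" where
  "labels F v = v ` {1..arity F}"

lemma labels_simps [simp]:
  "labels \<box> v = {v 1}"
  "labels Unit v = {}"
  "labels (F \<boxdot> G) v = labels F v \<union> labels G (shift (arity F) v)"
  unfolding labels_def image_arity_Mult by simp_all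

lemma labels_cong: "\<forall>i\<in>{1..arity F}. v i = v' i \<Longrightarrow> labels F v = labels F v'"
  unfolding labels_def by (rule image_cong) auto

text \<open>Turns a labelling \<open>v\<close> into the extensional tuple of objects at which a
  family is evaluated. Both \<open>slice\<close> and the reindexing by a graph become operations on
  \<open>v\<close>.\<close>

definition pull :: "nat \<Rightarrow> (nat \<Rightarrow> 'o) \<Rightarrow> (nat \<Rightarrow> nat) \<Rightarrow> nat \<Rightarrow> 'o" where
  "pull m X v = compose {1..m} X v"

lemma slice_pull: "k + l \<le> m \<Longrightarrow> slice k l (pull m X v) = pull l X (shift k v)"
  by (auto simp: slice_def pull_def compose_def shift_def restrict_def fun_eq_iff)

lemma pull_cong: "(\<And>i. i \<in> {1..m} \<Longrightarrow> v i = v' i) \<Longrightarrow> pull m X v = pull m X v'"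
  by (auto simp: pull_def compose_def restrict_def fun_eq_iff)

lemma compose_pull:
  assumes "\<Gamma> ` {1..l} \<subseteq> {1..m}"
  shows "compose {1..l} (pull m X v) \<Gamma> = pull l X (\<lambda>i. v (\<Gamma> i))"
  using assms by (auto simp: pull_def compose_def restrict_def fun_eq_iff image_subset_iff)

text \<open>Graphs are surjective: the primitive ones permute or duplicate arguments, never delete
  them. One inclusion licenses \<open>compose_pull\<close>; equality gives
  \<open>canonical_labels\<close>.\<close>

lemma canonical_graph_image: "canonical C F G \<Gamma> \<alpha> \<Longrightarrow> \<Gamma> ` {1..arity G} = {1..arity F}"
proof (induction rule: canonical.induct)
  case (canonical_sym F G)
  have "swap_graph (arity F) (arity G) ` {1..arity G} = {arity F + 1..arity F + arity G}"
  proof -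
    have "swap_graph (arity F) (arity G) ` {1..arity G} = (\<lambda>i. arity F + i) ` {1..arity G}"
      by (rule image_cong) (auto simp: swap_graph_def)
    then show ?thesis by (simp add: add.commute)
  qed
  moreover have "shift (arity G) (swap_graph (arity F) (arity G)) ` {1..arity F} = id ` {1..arity F}"
    by (rule image_cong) (auto simp: swap_graph_def shift_def)
  ultimately show ?case by (subst image_arity_Mult) auto
next
  case (canonical_diag F)
  have "diag_graph (arity F) ` {1..arity F} = id ` {1..arity F}"
    by (rule image_cong) (auto simp: diag_graph_def)
  moreover have "shift (arity F) (diag_graph (arity F)) ` {1..arity F} = id ` {1..arity F}"
    by (rule image_cong) (auto simp: diag_graph_def shift_def)
  ultimately show ?case by (subst image_arity_Mult) simp
next
  case (canonical_mult F\<^sub>1 G\<^sub>1 \<Phi> \<alpha> F\<^sub>2 G\<^sub>2 \<Psi> \<beta>)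
  let ?\<Gamma> = "mult_graph (arity F\<^sub>1) (arity G\<^sub>1) (arity G\<^sub>2) \<Phi> \<Psi>"
  have 1: "?\<Gamma> ` {1..arity G\<^sub>1} = \<Phi> ` {1..arity G\<^sub>1}"
    by (rule image_cong) (auto simp: mult_graph_def)
  have "shift (arity G\<^sub>1) ?\<Gamma> ` {1..arity G\<^sub>2} = (\<lambda>i. arity F\<^sub>1 + \<Psi> i) ` {1..arity G\<^sub>2}"
    by (rule image_cong) (auto simp: mult_graph_def shift_def)
  also have "\<dots> = (\<lambda>i. arity F\<^sub>1 + i) ` {1..arity F\<^sub>2}"
    by (simp only: canonical_mult.IH(2)[symmetric] image_image)
  also have "\<dots> = {arity F\<^sub>1 + 1..arity F\<^sub>1 + arity F\<^sub>2}" by (simp add: add.commute)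
  finally show ?case
    by (subst image_arity_Mult) (use 1 canonical_mult.IH(1) in auto)
next
  case (canonical_comp F G \<Phi> \<alpha> H \<Psi> \<beta>)
  have "compose {1..arity H} \<Phi> \<Psi> ` {1..arity H} = \<Phi> ` \<Psi> ` {1..arity H}"
    by (simp add: compose_def image_image)
  then show ?case using canonical_comp.IH by simp
qed (simp_all add: id_graph_def add.assoc)

lemma canonical_extensional: "canonical C F G \<Gamma> \<alpha> \<Longrightarrow> \<alpha> \<in> extensional (tuples C (arity F))"
  by (induction rule: canonical.induct) (auto simp: extensional_def add.assoc)

section \<open>The arrow from the variables to a labelled shape\<close>

context relevant_category
begin

text \<open>
  The values \<open>v 1, v 2, \<dots>\<close> of a valuation name variables, and the variable \<open>k\<close> stands for the object
  \<open>X k\<close>.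
\<close>

primrec shape_val :: "(nat \<Rightarrow> 'o) \<Rightarrow> shape \<Rightarrow> (nat \<Rightarrow> nat) \<Rightarrow> 'o" where
  "shape_val X \<box> v = X (v 1)"
| "shape_val X Unit v = \<I>"
| "shape_val X (F \<boxdot> G) v = shape_val X F v \<odot> shape_val X G (shift (arity F) v)"

text \<open>
  The arrow from the product of the distinct variables occurring in \<open>F\<close> under \<open>v\<close> to the value of \<open>F\<close>
  which, by coherence, has to be the only canonical one.
\<close>

primrec expand :: "(nat \<Rightarrow> 'o) \<Rightarrow> nat \<Rightarrow> shape \<Rightarrow> (nat \<Rightarrow> nat) \<Rightarrow> 'a" where
  "expand X n \<box> v = prod_var X n (v 1)"
| "expand X n Unit v = prod_unit X n"
| "expand X n (F \<boxdot> G) v = (expand X n F v \<otimes> expand X n G (shift (arity F) v)) \<bullet>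
    prod_split X n (labels F v) (labels G (shift (arity F) v))"

lemma shape_val_Obj [simp]: "range X \<subseteq> Obj C \<Longrightarrow> shape_val X F v \<in> Obj C"
  by (induction F arbitrary: v) auto

lemma shape_obj_pull: "shape_obj C F (pull (arity F) X v) = shape_val X F v"
proof (induction F arbitrary: v)
  case (Mult F G)
  then show ?case by (simp add: slice_pull)
qed (simp_all add: pull_def compose_def)

text \<open>Graphs are \<open>undefined\<close> outside their domain, so the labellings that they
  induce agree with the intended ones up to the arity only.\<close>

lemma shape_val_cong: "\<forall>i\<in>{1..arity F}. v i = v' i \<Longrightarrow> shape_val X F v = shape_val X F v'"
  unfolding shape_obj_pull[symmetric] by (metis pull_cong)

lemma expand_cong: "\<forall>i\<in>{1..arity F}. v i = v' i \<Longrightarrow> expand X n F v = expand X n F v'"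
proof (induction F arbitrary: v v')
  case (Mult F G)
  have 1: "\<forall>i\<in>{1..arity F}. v i = v' i" using Mult.prems by simp
  have 2: "\<forall>i\<in>{1..arity G}. shift (arity F) v i = shift (arity F) v' i"
    using Mult.prems by (simp add: shift_def)
  show ?case
    unfolding expand.simps by (simp only: Mult.IH(1)[OF 1] Mult.IH(2)[OF 2] labels_cong[OF 1] labels_cong[OF 2])
qed auto

lemma expand_arr [simp]:
  assumes X: "range X \<subseteq> Obj C"
  shows "labels F v \<subseteq> {..<n} \<Longrightarrow> expand X n F v \<in> Arr C \<and>
    Dom C (expand X n F v) = prod_obj X n (labels F v) \<and> Cod C (expand X n F v) = shape_val X F v"
proof (induction F arbitrary: v)
  case (Mult F G)
  then show ?case using X by simp
qed (use X in auto)

text \<open>Injectivity makes the label sets of the two factors disjoint at every product, so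
  \<open>has_section_prod_split\<close> applies throughout.\<close>

lemma has_section_expand:
  assumes X: "range X \<subseteq> Obj C"
  shows "labels F v \<subseteq> {..<n} \<Longrightarrow> inj_on v {1..arity F} \<Longrightarrow> has_section (expand X n F v)"
proof (induction F arbitrary: v)
  case Box
  then show ?case using has_section_prod_var[OF X] by simp
next
  case Unit
  show ?case by (simp add: has_section_prod_unit)
next
  case (Mult F G)
  have dom: "{1..arity F} \<subseteq> {1..arity (F \<boxdot> G)}" "{arity F + 1..arity F + arity G} \<subseteq> {1..arity (F \<boxdot> G)}"
    by auto
  have sub: "labels F v \<subseteq> {..<n}" "labels G (shift (arity F) v) \<subseteq> {..<n}"
    using Mult.prems(1) by simp_all
  have inj: "inj_on v {1..arity F}" using Mult.prems(2) dom(1) by (rule inj_on_subset)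
  have inj': "inj_on (shift (arity F) v) {1..arity G}"
  proof (rule inj_onI)
    fix i j assume ij: "i \<in> {1..arity G}" "j \<in> {1..arity G}" "shift (arity F) v i = shift (arity F) v j"
    have "arity F + i = arity F + j"
      by (rule inj_onD[OF Mult.prems(2)]) (use ij in \<open>simp_all add: shift_def\<close>)
    then show "i = j" by simp
  qed
  have "labels F v \<inter> labels G (shift (arity F) v) = {}"
    unfolding labels_def shift_image inj_on_image_Int[OF Mult.prems(2) dom, symmetric] by simp
  then have "has_section (prod_split X n (labels F v) (labels G (shift (arity F) v)))"
    by (rule has_section_prod_split[OF X])
  then show ?case
    unfolding expand.simps
    by (rule has_section_Comp[OF _ has_section_Mult[OF Mult.IH(1)[OF sub(1) inj] Mult.IH(2)[OF sub(2) inj']]])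
      (simp add: X sub)
qed

lemma expand_sigma:
  assumes X: "range X \<subseteq> Obj C" and v: "labels F v \<subseteq> {..<n}"
  shows "\<sigma> (shape_val X F v) \<bullet> expand X n (Unit \<boxdot> F) v = expand X n F v"
proof -
  let ?e = "expand X n F v" and ?P = "prod_obj X n (labels F v)"
  have "\<sigma> (shape_val X F v) \<bullet> expand X n (Unit \<boxdot> F) v =
      (\<sigma> (shape_val X F v) \<bullet> (\<one> \<I> \<otimes> ?e)) \<bullet> (prod_unit X n \<otimes> \<one> ?P) \<bullet> prod_split X n {} (labels F v)"
    using X v by simp
  also have "\<sigma> (shape_val X F v) \<bullet> (\<one> \<I> \<otimes> ?e) = ?e \<bullet> \<sigma> ?P"
    using X v by (intro sigma_nat) auto
  finally show ?thesis using X v by (simp add: prod_split_unit)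
qed

text \<open>Reduced to \<open>expand_sigma\<close>: by symmetry of \<open>prod_split\<close> the
  splitting with the empty set on the right is the one with it on the left, followed by a symmetry,
  and \<delta> absorbs that symmetry.\<close>

lemma expand_delta:
  assumes X: "range X \<subseteq> Obj C" and v: "labels F v \<subseteq> {..<n}"
  shows "\<delta> (shape_val X F v) \<bullet> expand X n (F \<boxdot> Unit) v = expand X n F v"
proof -
  let ?e = "expand X n F v" and ?S = "labels F v" let ?P = "prod_obj X n ?S"
  have "\<delta> (shape_val X F v) \<bullet> expand X n (F \<boxdot> Unit) v =
      \<delta> (shape_val X F v) \<bullet> (?e \<otimes> prod_unit X n) \<bullet> (\<c> (prod_obj X n {}) ?P \<bullet> prod_split X n {} ?S)"
    using X v by (simp add: sym_prod_split)
  also have "\<dots> = \<delta> (shape_val X F v) \<bullet> ((?e \<otimes> prod_unit X n) \<bullet> \<c> (prod_obj X n {}) ?P) \<bullet> prod_split X n {} ?S"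
    using X v by simp
  also have "(?e \<otimes> prod_unit X n) \<bullet> \<c> (prod_obj X n {}) ?P = \<c> \<I> (shape_val X F v) \<bullet> (prod_unit X n \<otimes> ?e)"
    using X v sym_nat[of "prod_unit X n" ?e] by simp
  also have "\<delta> (shape_val X F v) \<bullet> (\<c> \<I> (shape_val X F v) \<bullet> (prod_unit X n \<otimes> ?e)) \<bullet> prod_split X n {} ?S =
      \<sigma> (shape_val X F v) \<bullet> expand X n (Unit \<boxdot> F) v"
    using X v by (simp add: Comp_reassoc[OF delta_sym])
  finally show ?thesis using expand_sigma[OF assms] by simp
qed

text \<open>Naturality of \<open>br\<close> moves it past the arrows of the three factors; the rest
  is \<open>prod_split_assoc\<close>.\<close>

lemma expand_b_right:
  assumes X: "range X \<subseteq> Obj C" and v: "labels (F \<boxdot> G \<boxdot> H) v \<subseteq> {..<n}"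
  shows "br (shape_val X F v) (shape_val X G (shift (arity F) v)) (shape_val X H (shift (arity F + arity G) v)) \<bullet>
      expand X n (F \<boxdot> (G \<boxdot> H)) v = expand X n ((F \<boxdot> G) \<boxdot> H) v"
proof -
  let ?g = "shift (arity F) v" and ?h = "shift (arity F + arity G) v"
  let ?S = "labels F v" and ?T = "labels G ?g" and ?U = "labels H ?h"
  let ?ef = "expand X n F v" and ?eg = "expand X n G ?g" and ?eh = "expand X n H ?h"
  have "br (shape_val X F v) (shape_val X G ?g) (shape_val X H ?h) \<bullet> expand X n (F \<boxdot> (G \<boxdot> H)) v =
      (br (shape_val X F v) (shape_val X G ?g) (shape_val X H ?h) \<bullet> (?ef \<otimes> ?eg \<otimes> ?eh)) \<bullet>
      (\<one> (prod_obj X n ?S) \<otimes> prod_split X n ?T ?U) \<bullet> prod_split X n ?S (?T \<union> ?U)"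
    using X v by (simp add: add.assoc)
  also have "br (shape_val X F v) (shape_val X G ?g) (shape_val X H ?h) \<bullet> (?ef \<otimes> ?eg \<otimes> ?eh) =
      ((?ef \<otimes> ?eg) \<otimes> ?eh) \<bullet> br (prod_obj X n ?S) (prod_obj X n ?T) (prod_obj X n ?U)"
    using X v by (simp add: br_nat)
  also have "\<dots> \<bullet> (\<one> (prod_obj X n ?S) \<otimes> prod_split X n ?T ?U) \<bullet> prod_split X n ?S (?T \<union> ?U) =
      ((?ef \<otimes> ?eg) \<otimes> ?eh) \<bullet> (prod_split X n ?S ?T \<otimes> \<one> (prod_obj X n ?U)) \<bullet> prod_split X n (?S \<union> ?T) ?U"
    using X v by (simp add: prod_split_assoc)
  also have "\<dots> = expand X n ((F \<boxdot> G) \<boxdot> H) v"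
    using X v by (simp add: add.assoc)
  finally show ?thesis .
qed

lemma expand_sym:
  assumes X: "range X \<subseteq> Obj C" and v: "labels (F \<boxdot> G) v \<subseteq> {..<n}"
  shows "\<c> (shape_val X F v) (shape_val X G (shift (arity F) v)) \<bullet> expand X n (F \<boxdot> G) v =
    (expand X n G (shift (arity F) v) \<otimes> expand X n F v) \<bullet>
    prod_split X n (labels G (shift (arity F) v)) (labels F v)"
proof -
  let ?f = "expand X n F v" and ?g = "expand X n G (shift (arity F) v)"
  let ?S = "labels F v" and ?T = "labels G (shift (arity F) v)"
  have sub: "?S \<subseteq> {..<n}" "?T \<subseteq> {..<n}" using v by auto
  have "\<c> (shape_val X F v) (shape_val X G (shift (arity F) v)) \<bullet> expand X n (F \<boxdot> G) v =
      (\<c> (shape_val X F v) (shape_val X G (shift (arity F) v)) \<bullet> (?f \<otimes> ?g)) \<bullet> prod_split X n ?S ?T"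
    using X sub by simp
  also have "\<c> (shape_val X F v) (shape_val X G (shift (arity F) v)) \<bullet> (?f \<otimes> ?g) =
      (?g \<otimes> ?f) \<bullet> \<c> (prod_obj X n ?S) (prod_obj X n ?T)"
    using X sub sym_nat[of ?f ?g] by simp
  finally show ?thesis using X sub by (simp add: sym_prod_split)
qed

text \<open>Here it matters that the source product has one factor per label and not per occurrence:
  a shape and its square share that source, and naturality of \<open>w\<close> compares
  them.\<close>

lemma expand_diag:
  assumes X: "range X \<subseteq> Obj C" and v: "labels F v \<subseteq> {..<n}"
  shows "\<w> (shape_val X F v) \<bullet> expand X n F v =
    (expand X n F v \<otimes> expand X n F v) \<bullet> prod_split X n (labels F v) (labels F v)"
  using X v diag_nat[of "expand X n F v"] by (simp add: prod_split_diag)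

section \<open>Canonical transformations respect \<open>expand\<close>\<close>

lemma pull_tuples [simp]: "range X \<subseteq> Obj C \<Longrightarrow> pull m X v \<in> tuples C m"
  by (auto simp: tuples_def pull_def compose_def)

lemma shape_val_id_graph [simp]: "shape_val X F (\<lambda>i. v (id_graph (arity F) i)) = shape_val X F v"
  by (rule shape_val_cong) (simp add: id_graph_def)

lemma expand_id_graph [simp]: "expand X n F (\<lambda>i. v (id_graph (arity F) i)) = expand X n F v"
  by (rule expand_cong) (simp add: id_graph_def)

lemma canonical_labels:
  assumes "canonical C F G \<Gamma> \<alpha>"
  shows "labels G (\<lambda>i. v (\<Gamma> i)) = labels F v"
  unfolding labels_def canonical_graph_image[OF assms, symmetric] image_image ..

text \<open>The valuation is arbitrary because products use it shifted and composites use it after a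
  graph, where labels may repeat. Typing is part of the claim since composing and cancelling depend
  on it.\<close>

lemma canonical_expand:
  assumes "canonical C F G \<Gamma> \<alpha>" and X: "range X \<subseteq> Obj C"
  shows "labels F v \<subseteq> {..<n} \<Longrightarrow>
    \<alpha> (pull (arity F) X v) \<in> Arr C \<and>
    Dom C (\<alpha> (pull (arity F) X v)) = shape_val X F v \<and>
    Cod C (\<alpha> (pull (arity F) X v)) = shape_val X G (\<lambda>i. v (\<Gamma> i)) \<and>
    \<alpha> (pull (arity F) X v) \<bullet> expand X n F v = expand X n G (\<lambda>i. v (\<Gamma> i))"
  using assms(1)
proof (induction arbitrary: v rule: canonical.induct)
  case (canonical_id F)
  then show ?case
    using X by (simp add: shape_obj_pull)
next
  case (canonical_sigma F)
  have "\<sigma> (shape_val X F v) \<bullet> expand X n (Unit \<boxdot> F) v = expand X n F v"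
    using canonical_sigma X by (intro expand_sigma) auto
  then show ?case using X by (simp add: shape_obj_pull del: expand.simps)
next
  case (canonical_sigma_inv F)
  have e: "\<sigma> (shape_val X F v) \<bullet> expand X n (Unit \<boxdot> F) v = expand X n F v"
    using canonical_sigma_inv X by (intro expand_sigma) auto
  have "expand X n (Unit \<boxdot> F) (\<lambda>i. v (id_graph (arity F) i)) = expand X n (Unit \<boxdot> F) v"
    using expand_id_graph[of X n "Unit \<boxdot> F" v] by simp
  \<comment> \<open>For an inverse arrow, the equation of the arrow itself is composed with the
    inverse.\<close>
  moreover have "\<sigma>\<^sup>i (shape_val X F v) \<bullet> expand X n F v = expand X n (Unit \<boxdot> F) v"
    unfolding e[symmetric] using canonical_sigma_inv X by simp
  ultimately show ?case using X by (simp add: shape_obj_pull del: expand.simps)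
next
  case (canonical_delta F)
  have "\<delta> (shape_val X F v) \<bullet> expand X n (F \<boxdot> Unit) v = expand X n F v"
    using canonical_delta X by (intro expand_delta) auto
  then show ?case using X by (simp add: shape_obj_pull del: expand.simps)
next
  case (canonical_delta_inv F)
  have e: "\<delta> (shape_val X F v) \<bullet> expand X n (F \<boxdot> Unit) v = expand X n F v"
    using canonical_delta_inv X by (intro expand_delta) auto
  have "expand X n (F \<boxdot> Unit) (\<lambda>i. v (id_graph (arity F) i)) = expand X n (F \<boxdot> Unit) v"
    using expand_id_graph[of X n "F \<boxdot> Unit" v] by simp
  moreover have "\<delta>\<^sup>i (shape_val X F v) \<bullet> expand X n F v = expand X n (F \<boxdot> Unit) v"
    unfolding e[symmetric] using canonical_delta_inv X by simp
  ultimately show ?case using X by (simp add: shape_obj_pull del: expand.simps)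
next
  case (canonical_b_right F G H)
  have "br (shape_val X F v) (shape_val X G (shift (arity F) v)) (shape_val X H (shift (arity F + arity G) v)) \<bullet>
      expand X n (F \<boxdot> (G \<boxdot> H)) v = expand X n ((F \<boxdot> G) \<boxdot> H) v"
    using canonical_b_right X by (intro expand_b_right) auto
  moreover have "expand X n ((F \<boxdot> G) \<boxdot> H) (\<lambda>i. v (id_graph (arity F + arity G + arity H) i)) = expand X n ((F \<boxdot> G) \<boxdot> H) v"
    "shape_val X ((F \<boxdot> G) \<boxdot> H) (\<lambda>i. v (id_graph (arity F + arity G + arity H) i)) = shape_val X ((F \<boxdot> G) \<boxdot> H) v"
    using expand_id_graph[of X n "(F \<boxdot> G) \<boxdot> H" v] shape_val_id_graph[of X "(F \<boxdot> G) \<boxdot> H" v] by simp_all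
  ultimately show ?case
    using X by (simp add: slice_pull shape_obj_pull add.assoc[symmetric] del: expand.simps)
next
  case (canonical_b_left F G H)
  let ?b = "bl (shape_val X F v) (shape_val X G (shift (arity F) v)) (shape_val X H (shift (arity F + arity G) v))"
  have e: "br (shape_val X F v) (shape_val X G (shift (arity F) v)) (shape_val X H (shift (arity F + arity G) v)) \<bullet>
      expand X n (F \<boxdot> (G \<boxdot> H)) v = expand X n ((F \<boxdot> G) \<boxdot> H) v"
    using canonical_b_left X by (intro expand_b_right) auto
  have "?b \<bullet> expand X n ((F \<boxdot> G) \<boxdot> H) v = expand X n (F \<boxdot> (G \<boxdot> H)) v"
    unfolding e[symmetric] using canonical_b_left X by simp
  moreover have "expand X n (F \<boxdot> (G \<boxdot> H)) (\<lambda>i. v (id_graph (arity F + arity G + arity H) i)) = expand X n (F \<boxdot> (G \<boxdot> H)) v"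
    "shape_val X (F \<boxdot> (G \<boxdot> H)) (\<lambda>i. v (id_graph (arity F + arity G + arity H) i)) = shape_val X (F \<boxdot> (G \<boxdot> H)) v"
    using expand_id_graph[of X n "F \<boxdot> (G \<boxdot> H)" v] shape_val_id_graph[of X "F \<boxdot> (G \<boxdot> H)" v]
    by (simp_all add: add.assoc)
  ultimately show ?case
    using X by (simp add: slice_pull shape_obj_pull add.assoc[symmetric] del: expand.simps)
next
  case (canonical_sym F G)
  define g where "g = (\<lambda>i. v (swap_graph (arity F) (arity G) i))"
  have 1: "\<forall>i\<in>{1..arity G}. g i = shift (arity F) v i"
    by (simp add: g_def swap_graph_def shift_def)
  have 2: "\<forall>i\<in>{1..arity F}. shift (arity G) g i = v i"
    by (simp add: g_def swap_graph_def shift_def)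
  have "\<c> (shape_val X F v) (shape_val X G (shift (arity F) v)) \<bullet> expand X n (F \<boxdot> G) v = expand X n (G \<boxdot> F) g"
    unfolding expand.simps(3)[of X n G F] expand_cong[OF 1] expand_cong[OF 2] labels_cong[OF 1] labels_cong[OF 2]
    using canonical_sym X by (intro expand_sym) auto
  moreover have "shape_val X (G \<boxdot> F) g = shape_val X G (shift (arity F) v) \<odot> shape_val X F v"
    using shape_val_cong[OF 1] shape_val_cong[OF 2] by simp
  ultimately show ?case
    using X by (simp add: g_def slice_pull shape_obj_pull del: expand.simps shape_val.simps(3)) simp
next
  case (canonical_diag F)
  define g where "g = (\<lambda>i. v (diag_graph (arity F) i))"
  have 1: "\<forall>i\<in>{1..arity F}. g i = v i"
    by (simp add: g_def diag_graph_def)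
  have 2: "\<forall>i\<in>{1..arity F}. shift (arity F) g i = v i"
    by (simp add: g_def diag_graph_def shift_def)
  have "\<w> (shape_val X F v) \<bullet> expand X n F v = expand X n (F \<boxdot> F) g"
    unfolding expand.simps(3)[of X n F F] expand_cong[OF 1] expand_cong[OF 2] labels_cong[OF 1] labels_cong[OF 2]
    using canonical_diag X by (intro expand_diag) auto
  moreover have "shape_val X (F \<boxdot> F) g = shape_val X F v \<odot> shape_val X F v"
    using shape_val_cong[OF 1] shape_val_cong[OF 2] by simp
  ultimately show ?case
    using X by (simp add: g_def shape_obj_pull del: expand.simps shape_val.simps(3))
next
  case (canonical_mult F\<^sub>1 G\<^sub>1 \<Phi> \<alpha> F\<^sub>2 G\<^sub>2 \<Psi> \<beta>)
  define g where "g = (\<lambda>i. v (mult_graph (arity F\<^sub>1) (arity G\<^sub>1) (arity G\<^sub>2) \<Phi> \<Psi> i))"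
  let ?u = "shift (arity F\<^sub>1) v"
  have 1: "\<forall>i\<in>{1..arity G\<^sub>1}. g i = v (\<Phi> i)"
    by (simp add: g_def mult_graph_def)
  have 2: "\<forall>i\<in>{1..arity G\<^sub>2}. shift (arity G\<^sub>1) g i = ?u (\<Psi> i)"
    by (simp add: g_def mult_graph_def shift_def)
  have sub: "labels F\<^sub>1 v \<subseteq> {..<n}" "labels F\<^sub>2 ?u \<subseteq> {..<n}" using canonical_mult.prems by auto
  note IH = canonical_mult.IH(1)[OF sub(1)] canonical_mult.IH(2)[OF sub(2)]
  \<comment> \<open>Equal label sets mean that source and target use the same
    \<open>prod_split\<close>.\<close>
  have l: "labels G\<^sub>1 (\<lambda>i. v (\<Phi> i)) = labels F\<^sub>1 v" "labels G\<^sub>2 (\<lambda>i. ?u (\<Psi> i)) = labels F\<^sub>2 ?u"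
    using canonical_mult.hyps by (simp_all only: canonical_labels)
  let ?a = "\<alpha> (pull (arity F\<^sub>1) X v)" and ?b = "\<beta> (pull (arity F\<^sub>2) X ?u)"
  have "(?a \<otimes> ?b) \<bullet> expand X n (F\<^sub>1 \<boxdot> F\<^sub>2) v =
      ((?a \<bullet> expand X n F\<^sub>1 v) \<otimes> (?b \<bullet> expand X n F\<^sub>2 ?u)) \<bullet> prod_split X n (labels F\<^sub>1 v) (labels F\<^sub>2 ?u)"
    using X IH sub by simp
  also have "\<dots> = expand X n (G\<^sub>1 \<boxdot> G\<^sub>2) g"
    unfolding expand.simps(3)[of X n G\<^sub>1 G\<^sub>2] expand_cong[OF 1] expand_cong[OF 2] labels_cong[OF 1] labels_cong[OF 2] l
    using IH by simp
  finally have "(?a \<otimes> ?b) \<bullet> expand X n (F\<^sub>1 \<boxdot> F\<^sub>2) v = expand X n (G\<^sub>1 \<boxdot> G\<^sub>2) g" .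
  moreover have "shape_val X (G\<^sub>1 \<boxdot> G\<^sub>2) g = shape_val X G\<^sub>1 (\<lambda>i. v (\<Phi> i)) \<odot> shape_val X G\<^sub>2 (\<lambda>i. ?u (\<Psi> i))"
    using shape_val_cong[OF 1] shape_val_cong[OF 2] by simp
  ultimately show ?case
    using X IH by (simp add: g_def slice_pull del: expand.simps shape_val.simps(3)) simp
next
  case (canonical_comp F G \<Phi> \<alpha> H \<Psi> \<beta>)
  have \<Phi>: "\<Phi> ` {1..arity G} = {1..arity F}"
    using canonical_comp.hyps by (simp only: canonical_graph_image)
  have l: "labels G (\<lambda>i. v (\<Phi> i)) = labels F v"
    using canonical_comp.hyps(1) by (rule canonical_labels)
  have p: "compose {1..arity G} (pull (arity F) X v) \<Phi> = pull (arity G) X (\<lambda>i. v (\<Phi> i))"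
    using \<Phi> by (intro compose_pull) simp
  \<comment> \<open>The second hypothesis is taken at the relabelled valuation; its label set is
    that of \<open>F\<close> under \<open>v\<close>, so the bound \<open>n\<close> persists.\<close>
  note IH = canonical_comp.IH(1)[OF canonical_comp.prems]
    canonical_comp.IH(2)[of "\<lambda>i. v (\<Phi> i)", unfolded l, OF canonical_comp.prems]
  define g h where "g = (\<lambda>i. v (compose {1..arity H} \<Phi> \<Psi> i))" and "h = (\<lambda>i. v (\<Phi> (\<Psi> i)))"
  have 1: "\<forall>i\<in>{1..arity H}. g i = h i"
    by (simp add: g_def h_def compose_def)
  show ?case
    unfolding g_def[symmetric] expand_cong[OF 1] shape_val_cong[OF 1] unfolding h_def
    using X IH canonical_comp.prems by (simp add: p[unfolded One_nat_def])
qed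

lemma canonical_unique:
  assumes \<alpha>: "canonical C F G \<Gamma> \<alpha>" and \<beta>: "canonical C F G \<Gamma> \<beta>"
  shows "\<alpha> = \<beta>"
proof (rule extensionalityI[OF canonical_extensional[OF \<alpha>] canonical_extensional[OF \<beta>]])
  fix A assume A: "A \<in> tuples C (arity F)"
  let ?m = "arity F"
  \<comment> \<open>The unit fills the places outside the tuple, so that every variable names an
    object. Under the labelling \<open>id\<close> all boxes of \<open>F\<close> carry distinct
    variables.\<close>
  define X where "X = (\<lambda>i. if i \<in> {1..?m} then A i else \<I>)"
  have X: "range X \<subseteq> Obj C" using A by (auto simp: X_def tuples_def)
  have "pull ?m X id = A"
    using A by (auto simp: X_def pull_def compose_def tuples_def fun_eq_iff PiE_def extensional_def)
  \<comment> \<open>Labels run from 1 to \<open>?m\<close> while products range over indices below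
    the bound, hence \<open>Suc ?m\<close>.\<close>
  moreover have sub: "labels F id \<subseteq> {..<Suc ?m}" by (auto simp: labels_def)
  moreover have "has_section (expand X (Suc ?m) F id)"
    using X sub by (rule has_section_expand) simp
  \<comment> \<open>Both composites with the arrow of \<open>F\<close> equal the arrow of
    \<open>G\<close> labelled by \<Gamma>, an expression that mentions neither \<alpha> nor
    \<beta>.\<close>
  ultimately show "\<alpha> A = \<beta> A"
    using canonical_expand[OF \<alpha> X sub] canonical_expand[OF \<beta> X sub] X
    by - (rule has_section_cancel[of "expand X (Suc ?m) F id"]; simp)
qed

end

theorem theorem1:
  fixes C :: "('o, 'a) relevant_category"
    and F G :: shape
    and \<Gamma> :: "nat \<Rightarrow> nat"
    and \<alpha> \<beta> :: "(nat \<Rightarrow> 'o) \<Rightarrow> 'a"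
  assumes "relevant_category C"
    and "canonical C F G \<Gamma> \<alpha>"
    and "canonical C F G \<Gamma> \<beta>"
  shows "\<alpha> = \<beta>"
  using assms by (rule relevant_category.canonical_unique)

end
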